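(* Let $\mathcal{P}$ be an order-hereditary property of $k$-colourings with $\mathcal{P}_n\ne\emptyset$ for every $n$, and suppose $\mathcal{S}$ is a strong stability family for $\mathcal{P}$. For all $\varepsilon>0$ there exists $n_0\in\mathbb{N}$ such that for all $n\ge n_0$ there are at most $\varepsilon|\mathcal{P}_n|$ colourings $c\in\mathcal{P}_n$ with $\rho(c,\langle\mathcal{S}\rangle)>\varepsilon\binom n2$.
   Context: $k\ge2$ is a fixed integer and $[k]=\{1,\dots,k\}$. $K_n$ is the complete graph on vertex set $[n]$. A $k$-colouring of $K_n$ is a function $c:E(K_n)\to[k]$. For $A=\{a_1<\dots<a_m\}\subseteq[n]$ the restriction $c_{|A}$ is the $k$-colouring of $K_m$ with $c_{|A}(ij)=c(a_ia_j)$. An order-hereditary property is a sequence $\mathcal{P}=(\mathcal{P}_n)_{n}$ where $\mathcal{P}_n$ is a set of $k$-colourings of $K_n$ and $c_{|A}\in\mathcal{P}_{|A|}$ whenever $c\in\mathcal{P}_n$, $A\subseteq[n]$. A template for $K_n$ is a function $t$ assigning to each edge a nonempty set $t(e)\subseteq[k]$; $t_{|A}$ is defined by $t_{|A}(ij)=t(a_ia_j)$; $\langle t\rangle$ is the set of realisations of $t$ ($k$-colourings $c$ of $K_n$ with $c(e)\in t(e)$ for all $e$); $\mathrm{Ent}(t)=\sum_e\log_k|t(e)|$. $\mathrm{ex}(n,\mathcal{P})=\max\{\mathrm{Ent}(t):\langle t\rangle\subseteq\mathcal{P}_n\}$ and $\pi(\mathcal{P})=\lim_{n\to\infty}\mathrm{ex}(n,\mathcal{P})/\binom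 n2$ (the limit exists). A template sequence is $\mathbf{t}=(t_n)_{n\in\mathbb{N}}$ with $t_n$ a $k$-colouring template for $K_n$. The edit distance $\rho(s,t)$ between two templates for $K_n$ is the number of edges $e$ with $s(e)\ne t(e)$; for two colourings $c,c'$ of $K_n$, $\rho(c,c')$ is the number of edges on which they differ. For a family $\mathcal{S}$ of template sequences, $\langle\mathcal{S}\rangle$ denotes the realisations of the templates occurring in sequences of $\mathcal{S}$, and for a $k$-colouring $c$ of $K_n$, $\rho(c,\langle\mathcal{S}\rangle)$ is the minimum of $\rho(c,c')$ over all $c'\in\langle t_n\rangle$ with $(t_j)_j\in\mathcal{S}$. A family $\mathcal{S}$ of $k$-colouring template sequences is a strong stability family for $\mathcal{P}$ if for all $\varepsilon>0$ there exist $\delta>0$ and $m,n_0\in\mathbb{N}$ such that for all $n\ge n_0$, every template $t$ for $K_n$ satisfying (i) $\mathrm{Ent}(t)\ge(\pi(\mathcal{P})-\delta)\binom n2$ and (ii) there are at most $\delta\binom nm$ pairs $(A,c)$ where $A$ is an $m$-subset of $[n]$ and $c\in\langle t_{|A}\rangle$ with $c\notin\mathcal{P}_m$, lies within edit distance at most $\varepsilon\binom n2$ of the $n$-th term $t_n$ of some template sequence in $\mathcal{S}$. *)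

theory Defs
  imports Complex_Main "HOL-Library.FuncSet" "HOL-Library.Ramsey"
begin

text \<open>
  The vertex set of the complete graph on \<open>n\<close> vertices is \<open>{1..n}\<close>; an edge is a two-element
  subset. Colourings and templates are functions on edges that are \<open>undefined\<close> elsewhere, so that
  distinct elements of the sets below are distinct colourings (templates) and cardinalities are
  the intended ones.
\<close>

definition edges :: "nat \<Rightarrow> nat set set" where
  "edges n = [{1..n}]\<^bsup>2\<^esup>"

type_synonym colouring = "nat set \<Rightarrow> nat"
type_synonym template = "nat set \<Rightarrow> nat set"

definition colourings :: "nat \<Rightarrow> nat \<Rightarrow> colouring set" where
  "colourings k n = edges n \<rightarrow>\<^sub>E {1..k}"

definition templates :: "nat \<Rightarrow> nat \<Rightarrow> template set" where
  "templates k n = edges n \<rightarrow>\<^sub>E {X. X \<subseteq> {1..k} \<and> X \<noteq> {}}"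

text \<open>For \<open>A = {a\<^sub>1 < \<dots> < a\<^sub>m}\<close> this maps \<open>i \<in> {1..m}\<close> to \<open>a\<^sub>i\<close>; list positions start at 0.\<close>

definition nth_vertex :: "nat set \<Rightarrow> nat \<Rightarrow> nat" where
  "nth_vertex A i = sorted_list_of_set A ! (i - 1)"

text \<open>Polymorphic in the values, so that it applies to colourings as well as to templates.\<close>

definition restriction :: "(nat set \<Rightarrow> 'a) \<Rightarrow> nat set \<Rightarrow> (nat set \<Rightarrow> 'a)" where
  "restriction f A = (\<lambda>e\<in>edges (card A). f (nth_vertex A ` e))"

definition order_hereditary :: "nat \<Rightarrow> (nat \<Rightarrow> colouring set) \<Rightarrow> bool" where
  "order_hereditary k P \<longleftrightarrow>
     (\<forall>n. P n \<subseteq> colourings k n) \<and>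
     (\<forall>n. \<forall>c\<in>P n. \<forall>A. A \<subseteq> {1..n} \<longrightarrow> restriction c A \<in> P (card A))"

definition realisations :: "nat \<Rightarrow> template \<Rightarrow> colouring set" where
  "realisations n t = (\<Pi>\<^sub>E e\<in>edges n. t e)"

definition Ent :: "nat \<Rightarrow> nat \<Rightarrow> template \<Rightarrow> real" where
  "Ent k n t = (\<Sum>e\<in>edges n. log (real k) (real (card (t e))))"

definition extremal_entropy :: "nat \<Rightarrow> (nat \<Rightarrow> colouring set) \<Rightarrow> nat \<Rightarrow> real" where
  "extremal_entropy k P n = Max {Ent k n t | t. t \<in> templates k n \<and> realisations n t \<subseteq> P n}"

definition entropy_density :: "nat \<Rightarrow> (nat \<Rightarrow> colouring set) \<Rightarrow> real" where
  "entropy_density k P = lim (\<lambda>n. extremal_entropy k P n / real (n choose 2))"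

definition edit_distance :: "nat \<Rightarrow> (nat set \<Rightarrow> 'a) \<Rightarrow> (nat set \<Rightarrow> 'a) \<Rightarrow> nat" where
  "edit_distance n f g = card {e \<in> edges n. f e \<noteq> g e}"

definition template_sequences :: "nat \<Rightarrow> (nat \<Rightarrow> template) set" where
  "template_sequences k = {ts. \<forall>n. ts n \<in> templates k n}"

text \<open>
  The set of distances is finite (all are at most \<open>n choose 2\<close>), and nonempty whenever
  \<open>S\<close> is a nonempty family of template sequences, since every template has a realisation.
\<close>

definition family_distance :: "nat \<Rightarrow> colouring \<Rightarrow> (nat \<Rightarrow> template) set \<Rightarrow> nat" where
  "family_distance n c S =
     Min {edit_distance n c c' | c'. \<exists>ts\<in>S. c' \<in> realisations n (ts n)}"

definition strong_stability_family ::
  "nat \<Rightarrow> (nat \<Rightarrow> colouring set) \<Rightarrow> (nat \<Rightarrow> template) set \<Rightarrow> bool" where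
  "strong_stability_family k P S \<longleftrightarrow>
     S \<subseteq> template_sequences k \<and>
     (\<forall>\<epsilon>::real. \<epsilon> > 0 \<longrightarrow>
       (\<exists>\<delta>::real. \<delta> > 0 \<and> (\<exists>m n\<^sub>0 :: nat. \<forall>n\<ge>n\<^sub>0. \<forall>t\<in>templates k n.
          Ent k n t \<ge> (entropy_density k P - \<delta>) * real (n choose 2) \<longrightarrow>
          real (card {(A, c). A \<in> [{1..n}]\<^bsup>m\<^esup> \<and> c \<in> realisations m (restriction t A) \<and> c \<notin> P m})
            \<le> \<delta> * real (n choose m) \<longrightarrow>
          (\<exists>ts\<in>S. real (edit_distance n t (ts n)) \<le> \<epsilon> * real (n choose 2)))))"

end

theory Submission
  imports Defs
begin

text \<open>
  Fix a small \<open>\<beta>\<close>. The colourings in \<open>P n\<close> are covered by at most \<open>exp (\<beta> k (n choose 2))\<close>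
  templates, each with few bad pairs. Such a template either has entropy below
  \<open>(entropy_density k P - \<delta>) (n choose 2)\<close>, for the \<open>\<delta>\<close> of the stability hypothesis, and all of these
  together have far fewer than \<open>card (P n)\<close> realisations, or it is close to a template from the
  stability family, and then so are its realisations.

  The covering templates are found by repeatedly shrinking a template \<open>t\<close> with many bad pairs around
  a colouring \<open>c\<close>. A fixed forbidden pattern \<open>b\<close> has many copies in \<open>t\<close> but none in \<open>c\<close>.
  Switching its edges one at a time from \<open>t\<close> to \<open>c\<close>, we find an edge \<open>p\<close> of \<open>b\<close> at which the number of
  copies drops by a large factor, and by averaging this persists after fixing all vertices outside
  \<open>p\<close>. So there is a dense set \<open>F\<close> of edges that all have the colour \<open>b p\<close> available in \<open>t\<close>, but
  only a small fraction of them has this colour in \<open>c\<close>; deleting \<open>b p\<close> from \<open>t\<close> on the others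
  gives the smaller template. The set \<open>F\<close> depends only on \<open>t\<close> and on \<open>c\<close> at boundedly many
  vertices, so there are just \<open>exp (O(n))\<close> choices for it, and the choice of the exceptional subset
  of \<open>F\<close> is cheap compared with the loss of weight. The potential \<open>exp (\<beta> * weight)\<close> balances the two.
\<close>

section \<open>Templates, restrictions and extremal entropy\<close>

lemma card_nsets:
  assumes "finite A"
  shows "card ([A]\<^bsup>m\<^esup>) = card A choose m"
proof -
  have "[A]\<^bsup>m\<^esup> = {B. B \<subseteq> A \<and> card B = m}"
    using assms by (auto simp: nsets_def intro: finite_subset)
  then show ?thesis
    using n_subsets[OF assms] by simp
qed

lemma real_choose_two: "real (n choose 2) = real n * real (n - 1) / 2"
proof -
  have "2 dvd n * (n - 1)"
    by (cases n) auto
  then show ?thesis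
    by (simp only: choose_two real_of_nat_div of_nat_mult of_nat_numeral)
qed

lemma finite_edges [simp]: "finite (edges n)"
  by (simp add: edges_def finite_imp_finite_nsets)

lemma card_edges: "card (edges n) = n choose 2"
  by (simp add: edges_def card_nsets)

lemma finite_templates: "finite (templates k n)"
proof -
  have "finite {X. X \<subseteq> {1..k} \<and> X \<noteq> {}}"
    by (rule finite_subset[of _ "Pow {1..k}"]) auto
  then show ?thesis
    unfolding templates_def by (intro finite_PiE) auto
qed

lemma finite_colourings: "finite (colourings k n)"
  unfolding colourings_def by (intro finite_PiE) auto

lemma template_props:
  assumes "t \<in> templates k n" "e \<in> edges n"
  shows template_subset: "t e \<subseteq> {1..k}"
    and template_nonempty: "t e \<noteq> {}"
    and finite_template: "finite (t e)"
    and card_template_pos: "0 < card (t e)"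
proof -
  show *: "t e \<subseteq> {1..k}" "t e \<noteq> {}"
    using PiE_mem[OF assms[unfolded templates_def]] by auto
  then show "finite (t e)"
    using finite_subset by blast
  then show "0 < card (t e)"
    using * by (simp add: card_gt_0_iff)
qed

lemma realisations_subset_colourings:
  assumes "t \<in> templates k n"
  shows "realisations n t \<subseteq> colourings k n"
  using template_subset[OF assms] unfolding realisations_def colourings_def
  by (intro PiE_mono) auto

lemma realisation_mem:
  assumes "c \<in> realisations n t" "e \<in> edges n"
  shows "c e \<in> t e"
  using assms unfolding realisations_def by (rule PiE_mem)

section \<open>Increasing enumeration of a vertex set, and restriction along it\<close>

lemma nth_vertex_strict_mono:
  assumes "finite A"
  shows "strict_mono_on {1..card A} (nth_vertex A)"
proof (rule strict_mono_onI)
  fix i j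
  assume ij: "i \<in> {1..card A}" "j \<in> {1..card A}" "i < j"
  have "sorted_wrt (<) (sorted_list_of_set A)"
    by simp
  then show "nth_vertex A i < nth_vertex A j"
    unfolding nth_vertex_def using ij assms by (intro sorted_wrt_nth_less[of "(<)"]) auto
qed

lemma bij_betw_nth_vertex:
  assumes "finite A"
  shows "bij_betw (nth_vertex A) {1..card A} A"
proof -
  have inj: "inj_on (nth_vertex A) {1..card A}"
    using nth_vertex_strict_mono[OF assms] by (rule strict_mono_on_imp_inj_on)
  have "nth_vertex A ` {1..card A} \<subseteq> A"
  proof
    fix v assume "v \<in> nth_vertex A ` {1..card A}"
    then obtain i where "i \<in> {1..card A}" "v = sorted_list_of_set A ! (i - 1)"
      by (auto simp: nth_vertex_def)
    then have "v \<in> set (sorted_list_of_set A)"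
      using assms by (simp only:) (rule nth_mem, auto)
    then show "v \<in> A"
      using assms by simp
  qed
  then have "nth_vertex A ` {1..card A} = A"
    using inj assms by (intro card_subset_eq) (auto simp: card_image)
  then show ?thesis
    using inj by (simp add: bij_betw_def)
qed

lemma bij_betw_nth_vertex_image:
  assumes "finite A"
  shows "bij_betw ((`) (nth_vertex A)) (edges (card A)) ([A]\<^bsup>2\<^esup>)"
  unfolding edges_def using bij_betw_nth_vertex[OF assms] by (rule bij_betw_nsets)

lemma nth_vertex_image:
  assumes "strict_mono_on {1..m} x" "i \<in> {1..m}"
  shows "nth_vertex (x ` {1..m}) i = x i"
proof -
  have "sorted_wrt (<) (map x [1..<Suc m])"
    unfolding sorted_wrt_map sorted_wrt_iff_nth_less
    using strict_mono_onD[OF assms(1)] by (auto simp del: upt_Suc)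
  moreover have "set (map x [1..<Suc m]) = x ` {1..m}"
    by auto
  ultimately have "sorted_list_of_set (x ` {1..m}) = map x [1..<Suc m]"
    by (metis sorted_list_of_set.idem_if_sorted_distinct strict_sorted_iff)
  then show ?thesis
    using assms(2) by (auto simp: nth_vertex_def simp del: upt_Suc)
qed

lemma restriction_apply:
  "e \<in> edges (card A) \<Longrightarrow> restriction f A e = f (nth_vertex A ` e)"
  by (simp add: restriction_def)

lemma nth_vertex_image_edge:
  assumes "A \<subseteq> {1..N}" "e \<in> edges (card A)"
  shows "nth_vertex A ` e \<in> edges N" "nth_vertex A ` e \<in> [A]\<^bsup>2\<^esup>"
proof -
  have "finite A"
    using assms(1) finite_subset by blast
  then show *: "nth_vertex A ` e \<in> [A]\<^bsup>2\<^esup>"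
    using bij_betw_nth_vertex_image assms(2) bij_betw_apply by fastforce
  then show "nth_vertex A ` e \<in> edges N"
    using nsets_mono[OF assms(1)] by (auto simp: edges_def)
qed

lemma restriction_template:
  assumes "t \<in> templates k N" "A \<subseteq> {1..N}"
  shows "restriction t A \<in> templates k (card A)"
  unfolding templates_def
proof (rule PiE_I)
  fix e assume e: "e \<in> edges (card A)"
  note f = nth_vertex_image_edge(1)[OF assms(2) e]
  show "restriction t A e \<in> {X. X \<subseteq> {1..k} \<and> X \<noteq> {}}"
    using template_subset[OF assms(1) f] template_nonempty[OF assms(1) f]
    by (simp add: restriction_apply e)
qed (simp add: restriction_def)

text \<open>Inside \<open>A\<close> the colouring \<open>d\<close> is transported along the
  enumeration, and all other edges take any colour that \<open>t\<close> allows. This lets heredity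
  of the property pass from the realisations of \<open>t\<close> to those of its
  restriction.\<close>

lemma realisation_of_restriction:
  assumes "t \<in> templates k N" "A \<subseteq> {1..N}" "d \<in> realisations (card A) (restriction t A)"
  obtains c where "c \<in> realisations N t" "restriction c A = d"
proof -
  have "finite A"
    using assms(2) finite_subset by blast
  then have bij: "bij_betw ((`) (nth_vertex A)) (edges (card A)) ([A]\<^bsup>2\<^esup>)"
    by (rule bij_betw_nth_vertex_image)
  define g where "g = inv_into (edges (card A)) ((`) (nth_vertex A))"
  define c where
    "c = (\<lambda>f\<in>edges N. if f \<in> [A]\<^bsup>2\<^esup> then d (g f) else (SOME i. i \<in> t f))"
  have g: "g f \<in> edges (card A)" "nth_vertex A ` g f = f" if "f \<in> [A]\<^bsup>2\<^esup>" for f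
    using bij_betwE[OF bij_betw_inv_into[OF bij]] that bij_betw_inv_into_right[OF bij that]
    by (simp_all add: g_def)
  have "c \<in> realisations N t"
    unfolding realisations_def
  proof (rule PiE_I)
    fix f assume f: "f \<in> edges N"
    show "c f \<in> t f"
    proof (cases "f \<in> [A]\<^bsup>2\<^esup>")
      case True
      then have "d (g f) \<in> restriction t A (g f)"
        using realisation_mem[OF assms(3)] g by blast
      then show ?thesis
        using True f g by (simp add: c_def restriction_apply)
    next
      case False
      have "(SOME i. i \<in> t f) \<in> t f"
        using template_nonempty[OF assms(1) f] by (simp add: some_in_eq)
      then show ?thesis
        using False f by (simp add: c_def)
    qed
  qed (simp add: c_def)
  moreover have "restriction c A = d"
  proof (rule PiE_ext)
    show "restriction c A \<in> edges (card A) \<rightarrow>\<^sub>E UNIV"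
      by (simp add: restriction_def)
    show "d \<in> edges (card A) \<rightarrow>\<^sub>E UNIV"
      using assms(3) by (auto simp: realisations_def PiE_iff)
    fix e assume e: "e \<in> edges (card A)"
    have "g (nth_vertex A ` e) = e"
      unfolding g_def using bij e by (simp add: bij_betw_def)
    then show "restriction c A e = d e"
      using nth_vertex_image_edge[OF assms(2) e] e by (simp add: restriction_apply c_def)
  qed
  ultimately show thesis
    by (rule that)
qed

section \<open>Entropy and the number of realisations\<close>

lemma Ent_restriction:
  assumes "finite A"
  shows "Ent k (card A) (restriction t A) = (\<Sum>f\<in>[A]\<^bsup>2\<^esup>. log k (card (t f)))"
  unfolding Ent_def
  by (subst sum.reindex_bij_betw[OF bij_betw_nth_vertex_image[OF assms], symmetric])
    (simp add: restriction_apply)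

lemma Ent_nonneg:
  assumes "k \<ge> 2" "t \<in> templates k n"
  shows "Ent k n t \<ge> 0"
  unfolding Ent_def
proof (rule sum_nonneg)
  fix e assume "e \<in> edges n"
  then have "1 \<le> card (t e)"
    using card_template_pos[OF assms(2)] by fastforce
  then show "0 \<le> log k (card (t e))"
    using assms(1) by simp
qed

lemma card_realisations:
  assumes "k \<ge> 2" "t \<in> templates k n"
  shows "real (card (realisations n t)) = real k powr Ent k n t"
proof -
  have "real k powr Ent k n t = (\<Prod>e\<in>edges n. real k powr log k (card (t e)))"
    unfolding Ent_def using assms(1) by (intro powr_sum) auto
  also have "\<dots> = (\<Prod>e\<in>edges n. real (card (t e)))"
    using assms(1) card_template_pos[OF assms(2)] by (intro prod.cong) auto
  finally show ?thesis
    by (simp add: realisations_def card_PiE)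
qed

section \<open>Extremal entropy of a hereditary property and a lower bound for its size\<close>

context
  fixes k :: nat and P :: "nat \<Rightarrow> colouring set"
  assumes k: "k \<ge> 2"
    and hered: "order_hereditary k P"
    and nonempty: "\<And>n. P n \<noteq> {}"
begin

lemma property_subset: "P n \<subseteq> colourings k n"
  using hered by (simp add: order_hereditary_def)

lemma property_restriction: "c \<in> P N \<Longrightarrow> A \<subseteq> {1..N} \<Longrightarrow> restriction c A \<in> P (card A)"
  using hered by (simp add: order_hereditary_def)

lemma finite_property: "finite (P n)"
  using property_subset finite_colourings finite_subset by blast

lemma finite_feasible_entropies:
  "finite {Ent k n t | t. t \<in> templates k n \<and> realisations n t \<subseteq> P n}"
  by (rule finite_subset[OF _ finite_imageI[OF finite_templates[of k n], of "Ent k n"]]) auto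

lemma Ent_le_extremal_entropy:
  assumes "t \<in> templates k n" "realisations n t \<subseteq> P n"
  shows "Ent k n t \<le> extremal_entropy k P n"
  unfolding extremal_entropy_def using assms finite_feasible_entropies by (intro Max_ge) auto

lemma extremal_template:
  obtains t where "t \<in> templates k n" "realisations n t \<subseteq> P n" "Ent k n t = extremal_entropy k P n"
proof -
  obtain c where c: "c \<in> P n"
    using nonempty by blast
  then have col: "c \<in> edges n \<rightarrow>\<^sub>E {1..k}"
    using property_subset by (auto simp: colourings_def)
  \<comment> \<open>The template of singletons of one colouring in \<open>P n\<close> is feasible,
    so the maximum in \<open>extremal_entropy\<close> is taken over a nonempty set.\<close>
  define t where "t = (\<lambda>e\<in>edges n. {c e})"
  have "t \<in> templates k n"
    using col by (auto simp: templates_def t_def)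
  moreover have "realisations n t \<subseteq> {c}"
  proof
    fix d assume d: "d \<in> realisations n t"
    have "d = c"
    proof (rule PiE_ext[of _ "edges n" "\<lambda>_. UNIV"])
      show "d e = c e" if "e \<in> edges n" for e
        using realisation_mem[OF d that] that by (simp add: t_def)
    qed (use col d in \<open>auto simp: realisations_def PiE_iff\<close>)
    then show "d \<in> {c}"
      by simp
  qed
  ultimately have "{Ent k n t | t. t \<in> templates k n \<and> realisations n t \<subseteq> P n} \<noteq> {}"
    using c by blast
  then have "extremal_entropy k P n \<in> {Ent k n t | t. t \<in> templates k n \<and> realisations n t \<subseteq> P n}"
    unfolding extremal_entropy_def using finite_feasible_entropies by (intro Max_in) auto
  then show thesis
    using that by force
qed

lemma extremal_entropy_nonneg: "0 \<le> extremal_entropy k P n"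
  by (metis extremal_template Ent_nonneg[OF k])

text \<open>Averaging over the deletion of one vertex: an edge survives \<open>n - 1\<close> of the
  \<open>Suc n\<close> deletions, and each restriction is again feasible by heredity. After division
  by binomials this says that the extremal density does not increase.\<close>

lemma extremal_entropy_Suc:
  assumes "n \<ge> 2"
  shows "real (n - 1) * extremal_entropy k P (Suc n) \<le> real (Suc n) * extremal_entropy k P n"
proof -
  obtain t where t: "t \<in> templates k (Suc n)" "realisations (Suc n) t \<subseteq> P (Suc n)"
      "Ent k (Suc n) t = extremal_entropy k P (Suc n)"
    by (rule extremal_template)
  define A where "A v = {1..Suc n} - {v}" for v :: nat
  have A: "A v \<subseteq> {1..Suc n}" "finite (A v)" "card (A v) = n" if "v \<in> {1..Suc n}" for v
    using that by (auto simp: A_def)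
  let ?w = "\<lambda>f. log k (card (t f))"
  have le: "(\<Sum>f\<in>[A v]\<^bsup>2\<^esup>. ?w f) \<le> extremal_entropy k P n" if v: "v \<in> {1..Suc n}" for v
  proof -
    have "realisations n (restriction t (A v)) \<subseteq> P n"
    proof
      fix d assume "d \<in> realisations n (restriction t (A v))"
      then obtain c where "c \<in> realisations (Suc n) t" "restriction c (A v) = d"
        using realisation_of_restriction[OF t(1) A(1)[OF v]] A[OF v] by metis
      then show "d \<in> P n"
        using t(2) property_restriction[of c "Suc n" "A v"] A[OF v] by auto
    qed
    then have "Ent k n (restriction t (A v)) \<le> extremal_entropy k P n"
      using restriction_template[OF t(1) A(1)[OF v]] A[OF v] by (intro Ent_le_extremal_entropy) auto
    then show ?thesis
      using Ent_restriction[OF A(2)[OF v], of k t] A[OF v] by simp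
  qed
  have nsets_A: "[A v]\<^bsup>2\<^esup> = {f \<in> edges (Suc n). v \<notin> f}" for v
    by (auto simp: A_def nsets_def edges_def)
  have "(\<Sum>v\<in>{1..Suc n}. \<Sum>f\<in>[A v]\<^bsup>2\<^esup>. ?w f)
      = (\<Sum>f\<in>edges (Suc n). \<Sum>v\<in>{v \<in> {1..Suc n}. v \<notin> f}. ?w f)"
    unfolding nsets_A by (rule sum.swap_restrict) auto
  also have "\<dots> = (\<Sum>f\<in>edges (Suc n). real (n - 1) * ?w f)"
  proof (rule sum.cong[OF refl])
    fix f assume "f \<in> edges (Suc n)"
    then have f: "f \<subseteq> {1..Suc n}" "finite f" "card f = 2"
      by (auto simp: edges_def nsets_def)
    have "{v \<in> {1..Suc n}. v \<notin> f} = {1..Suc n} - f"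
      by auto
    then have "card {v \<in> {1..Suc n}. v \<notin> f} = n - 1"
      using f assms by (simp add: card_Diff_subset)
    then show "(\<Sum>v\<in>{v \<in> {1..Suc n}. v \<notin> f}. ?w f) = real (n - 1) * ?w f"
      by simp
  qed
  also have "\<dots> = real (n - 1) * extremal_entropy k P (Suc n)"
    by (simp add: t(3)[symmetric] Ent_def sum_distrib_left)
  finally have "real (n - 1) * extremal_entropy k P (Suc n)
      = (\<Sum>v\<in>{1..Suc n}. \<Sum>f\<in>[A v]\<^bsup>2\<^esup>. ?w f)" ..
  also have "\<dots> \<le> (\<Sum>v\<in>{1..Suc n}. extremal_entropy k P n)"
    by (intro sum_mono le)
  finally show ?thesis
    by simp
qed

text \<open>The densities decrease from index 2 on and are nonnegative, so the \<open>lim\<close> in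
  \<open>entropy_density\<close> is a genuine limit and lies below each of these terms.\<close>

lemma entropy_density_le:
  assumes "n \<ge> 2"
  shows "entropy_density k P * real (n choose 2) \<le> extremal_entropy k P n"
proof -
  define a where "a n = extremal_entropy k P n / real (n choose 2)" for n
  have step: "a (Suc j) \<le> a j" if "j \<ge> 2" for j
  proof -
    have c: "real (j choose 2) = real j * real (j - 1) / 2"
      "real (Suc j choose 2) = real (Suc j) * real j / 2"
      using real_choose_two[of j] real_choose_two[of "Suc j"] by simp_all
    show ?thesis
      unfolding a_def c using extremal_entropy_Suc[OF that] that
      by (simp add: field_simps del: of_nat_Suc of_nat_diff)
  qed
  have "decseq (\<lambda>j. a (j + n))"
    using step assms by (intro decseq_SucI) auto
  moreover have "0 \<le> a j" for j
    by (simp add: a_def extremal_entropy_nonneg)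
  ultimately obtain L where L: "(\<lambda>j. a (j + n)) \<longlonglongrightarrow> L" "\<And>j. L \<le> a (j + n)"
    using decseq_convergent[of "\<lambda>j. a (j + n)" 0] by blast
  have "a \<longlonglongrightarrow> L"
    using L(1) by (rule LIMSEQ_offset)
  then have "entropy_density k P = L"
    unfolding entropy_density_def a_def by (rule limI)
  then have "entropy_density k P \<le> a n"
    using L(2)[of 0] by simp
  moreover have "n choose 2 > 0"
    using assms by (simp add: zero_less_binomial)
  ultimately show ?thesis
    by (simp add: a_def field_simps)
qed

text \<open>An extremal template has all its realisations in \<open>P n\<close>. The containers of
  low entropy are compared with this bound at the end.\<close>

lemma card_property_ge:
  assumes "n \<ge> 2"
  shows "real k powr (entropy_density k P * real (n choose 2)) \<le> real (card (P n))"
proof -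
  obtain t where t: "t \<in> templates k n" "realisations n t \<subseteq> P n" "Ent k n t = extremal_entropy k P n"
    by (rule extremal_template)
  have "real k powr (entropy_density k P * real (n choose 2)) \<le> real k powr Ent k n t"
    using entropy_density_le[OF assms] t(3) k by (intro powr_mono) auto
  also have "\<dots> = real (card (realisations n t))"
    using card_realisations[OF k t(1)] by simp
  also have "\<dots> \<le> real (card (P n))"
    using card_mono[OF finite_property t(2)] by simp
  finally show ?thesis .
qed

end

section \<open>Counting lemmas\<close>

text \<open>An exponential moment bound. On small sets a factor
  \<open>exp (\<beta> / 4 * card F)\<close> buys the replacement of
  \<open>exp (\<beta> * card Y)\<close> by \<open>z ^ card Y\<close>; summed over all subsets this
  gives \<open>(z + 1) ^ card F\<close>, which for small \<open>z\<close> costs another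
  \<open>exp (\<beta> / 4 * card F)\<close>.\<close>

lemma small_subsets_sum:
  fixes \<beta> :: real
  assumes "\<beta> > 0"
  obtains \<theta> :: real where "0 < \<theta>" "\<theta> < 1"
    "\<And>F :: 'a set. finite F \<Longrightarrow>
      (\<Sum>Y | Y \<subseteq> F \<and> real (card Y) \<le> \<theta> * card F. exp (\<beta> * card Y)) \<le> exp (\<beta> / 2 * card F)"
proof -
  define z where "z = min 1 (\<beta> / 4)"
  have z: "0 < z" "z \<le> 1" "z \<le> \<beta> / 4"
    using assms by (auto simp: z_def)
  define L where "L = \<beta> - ln z"
  have L: "L > 0"
    using z assms by (simp add: L_def) (smt (verit) ln_le_zero_iff)
  \<comment> \<open>\<open>L\<close> is the logarithm of the ratio \<open>exp \<beta> / z\<close>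
    lost per element of \<open>Y\<close>, so at most \<open>\<theta> * card F\<close> elements lose
    at most \<open>\<beta> / 4 * card F\<close> in the exponent.\<close>
  define \<theta> where "\<theta> = min (1 / 2) (\<beta> / (4 * L))"
  have \<theta>: "0 < \<theta>" "\<theta> < 1" "L * \<theta> \<le> \<beta> / 4"
    using L assms by (auto simp: \<theta>_def min_def field_simps)
  have "(\<Sum>Y | Y \<subseteq> F \<and> real (card Y) \<le> \<theta> * card F. exp (\<beta> * card Y)) \<le> exp (\<beta> / 2 * card F)"
    if F: "finite F" for F :: "'a set"
  proof -
    have "exp (\<beta> * card Y) \<le> exp (\<beta> / 4 * card F) * z ^ card Y"
      if "real (card Y) \<le> \<theta> * card F" for Y :: "'a set"
    proof -
      have "L * card Y \<le> L * (\<theta> * card F)"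
        using that L by (intro mult_left_mono) auto
      also have "\<dots> \<le> \<beta> / 4 * card F"
        using mult_right_mono[OF \<theta>(3), of "real (card F)"] by (simp add: mult_ac)
      finally have "\<beta> * card Y \<le> \<beta> / 4 * card F + card Y * ln z"
        by (simp add: L_def algebra_simps)
      then have "exp (\<beta> * card Y) \<le> exp (\<beta> / 4 * card F) * exp (card Y * ln z)"
        by (simp flip: exp_add)
      also have "exp (card Y * ln z) = z ^ card Y"
        using z by (simp add: exp_of_nat_mult)
      finally show ?thesis .
    qed
    then have "(\<Sum>Y | Y \<subseteq> F \<and> real (card Y) \<le> \<theta> * card F. exp (\<beta> * card Y))
        \<le> (\<Sum>Y | Y \<subseteq> F \<and> real (card Y) \<le> \<theta> * card F. exp (\<beta> / 4 * card F) * z ^ card Y)"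
      by (intro sum_mono) auto
    also have "\<dots> \<le> (\<Sum>Y\<in>Pow F. exp (\<beta> / 4 * card F) * z ^ card Y)"
      using F z by (intro sum_mono2) auto
    also have "\<dots> = exp (\<beta> / 4 * card F) * (z + 1) ^ card F"
      using prod_add[OF F, of "\<lambda>_. z" "\<lambda>_. 1"] by (simp add: sum_distrib_left)
    also have "(z + 1) ^ card F \<le> exp z ^ card F"
      using z exp_ge_add_one_self[of z] by (intro power_mono) (simp_all add: add.commute)
    also have "exp z ^ card F = exp (card F * z)"
      by (simp add: exp_of_nat_mult)
    also have "exp (card F * z) \<le> exp (\<beta> / 4 * card F)"
      using mult_left_mono[OF z(3), of "real (card F)"] by (simp add: mult_ac)
    finally show ?thesis
      by (simp flip: exp_add)
  qed
  with \<theta> show thesis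
    using that by blast
qed

text \<open>Otherwise the recurrence \<open>a (Suc j) < \<mu> * a j + g\<close>, started at 0, keeps
  \<open>a j\<close> below \<open>j * g * \<mu> ^ j\<close>.\<close>

lemma exists_large_increment:
  fixes a :: "nat \<Rightarrow> real"
  assumes "a 0 = 0" "\<mu> \<ge> 1" "g \<ge> 0" "a r > r * g * \<mu> ^ r"
  shows "\<exists>j<r. a (Suc j) \<ge> \<mu> * a j + g"
proof (rule ccontr)
  assume "\<not> ?thesis"
  then have less: "a (Suc j) < \<mu> * a j + g" if "j < r" for j
    using that by force
  have "a j \<le> j * g * \<mu> ^ j" if "j \<le> r" for j
    using that
  proof (induction j)
    case (Suc j)
    then have "\<mu> * a j \<le> \<mu> * (j * g * \<mu> ^ j)"
      using assms(2) by (intro mult_left_mono) auto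
    then have "a (Suc j) \<le> \<mu> * (j * g * \<mu> ^ j) + g"
      using less[of j] Suc.prems by simp
    moreover have "g * 1 \<le> g * \<mu> ^ Suc j"
      using assms one_le_power[OF assms(2), of "Suc j"] by (intro mult_left_mono)
    ultimately show ?case
      by (simp add: algebra_simps)
  qed (simp add: assms)
  then show False
    using assms(4) by force
qed

text \<open>If all fibres violated the inequality, summing over \<open>W\<close> would contradict
  the global one.\<close>

lemma exists_rich_fibre:
  fixes \<mu> g :: real
  assumes "finite X" "Y \<subseteq> X" "finite W" "W \<noteq> {}" "\<phi> ` X \<subseteq> W"
    and "card X \<ge> \<mu> * card Y + g * card W"
  shows "\<exists>w\<in>W. card {x \<in> X. \<phi> x = w} \<ge> \<mu> * card {x \<in> Y. \<phi> x = w} + g"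
proof (rule ccontr)
  assume "\<not> ?thesis"
  then have less: "real (card {x \<in> X. \<phi> x = w}) < \<mu> * card {x \<in> Y. \<phi> x = w} + g" if "w \<in> W" for w
    using that by force
  have total: "real (card Z) = (\<Sum>w\<in>W. real (card {x \<in> Z. \<phi> x = w}))" if "Z \<subseteq> X" for Z
  proof -
    have "finite Z" "\<phi> ` Z \<subseteq> W"
      using that assms by (auto intro: finite_subset)
    then show ?thesis
      using sum.group[of Z W \<phi> "\<lambda>_. 1 :: real"] assms by simp
  qed
  have "real (card X) = (\<Sum>w\<in>W. real (card {x \<in> X. \<phi> x = w}))"
    by (rule total) simp
  also have "\<dots> < (\<Sum>w\<in>W. \<mu> * card {x \<in> Y. \<phi> x = w} + g)"
    using assms less by (intro sum_strict_mono) auto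
  also have "\<dots> = \<mu> * card Y + g * card W"
    using total[OF assms(2)] by (simp add: sum.distrib sum_distrib_left)
  finally show False
    using assms(6) by simp
qed

lemma exp_linear_le_exp_quadratic:
  fixes K b c :: real
  assumes "c > 0"
  shows "\<exists>n\<^sub>0. \<forall>n\<ge>n\<^sub>0. K * exp (b * real n) \<le> exp (c * real n ^ 2)"
proof (intro exI allI impI)
  fix n :: nat
  assume n: "n \<ge> nat \<lceil>(\<bar>K\<bar> + \<bar>b\<bar>) / c\<rceil> + 1"
  then have "real n \<ge> (\<bar>K\<bar> + \<bar>b\<bar>) / c" and n1: "real n \<ge> 1"
    by linarith+
  then have "\<bar>K\<bar> + \<bar>b\<bar> \<le> c * n"
    using assms by (simp add: field_simps)
  then have "(\<bar>K\<bar> + \<bar>b\<bar>) * n \<le> c * n * n"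
    by (intro mult_right_mono) auto
  moreover have "\<bar>K\<bar> * 1 \<le> \<bar>K\<bar> * n" "b * n \<le> \<bar>b\<bar> * n"
    using n1 by (intro mult_left_mono mult_right_mono; simp)+
  ultimately have "\<bar>K\<bar> + b * n \<le> c * real n ^ 2"
    by (simp add: algebra_simps power2_eq_square)
  moreover have "K \<le> exp \<bar>K\<bar>"
    using exp_ge_add_one_self[of "\<bar>K\<bar>"] by linarith
  then have "K * exp (b * n) \<le> exp (\<bar>K\<bar> + b * n)"
    by (simp add: exp_add)
  ultimately show "K * exp (b * real n) \<le> exp (c * real n ^ 2)"
    by (smt (verit) exp_le_cancel_iff)
qed

section \<open>Containers\<close>

text \<open>In contrast to \<open>Ent\<close>, this is a natural number that drops by exactly one
  for each deleted colour. It is both the induction measure and the exponent of the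
  potential.\<close>

definition weight :: "nat \<Rightarrow> template \<Rightarrow> nat" where
  "weight n t = (\<Sum>e\<in>edges n. card (t e))"

text \<open>The set counted in condition (ii) of \<open>strong_stability_family\<close>.\<close>

definition bad_pairs ::
  "(nat \<Rightarrow> colouring set) \<Rightarrow> nat \<Rightarrow> nat \<Rightarrow> template \<Rightarrow> (nat set \<times> colouring) set" where
  "bad_pairs P m n t =
     {(A, c). A \<in> [{1..n}]\<^bsup>m\<^esup> \<and> c \<in> realisations m (restriction t A) \<and> c \<notin> P m}"

text \<open>These maps stand for the \<open>m\<close>-subsets of \<open>{1..n}\<close>, by way of
  their enumerations. As functions they can be fixed on some vertices of the pattern and left free
  on the others.\<close>

definition increasing_maps :: "nat \<Rightarrow> nat \<Rightarrow> (nat \<Rightarrow> nat) set" where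
  "increasing_maps m n = {x \<in> {1..m} \<rightarrow>\<^sub>E {1..n}. strict_mono_on {1..m} x}"

text \<open>
  The enumeration \<open>h\<close> lists the edges of the complete graph on \<open>{1..m}\<close>; the embedded pattern
  \<open>b\<close> is compared with the template \<open>t\<close> on the first \<open>j\<close> edges and with the colouring \<open>c\<close> on the
  remaining ones, so that \<open>j\<close> interpolates between copies of \<open>b\<close> in \<open>c\<close> and in \<open>t\<close>.
\<close>

definition hybrid_copies ::
  "nat \<Rightarrow> nat \<Rightarrow> (nat \<Rightarrow> nat set) \<Rightarrow> colouring \<Rightarrow> template \<Rightarrow> colouring \<Rightarrow> nat \<Rightarrow> (nat \<Rightarrow> nat) set" where
  "hybrid_copies m n h b t c j =
     {x \<in> increasing_maps m n.
        (\<forall>l<j. b (h l) \<in> t (x ` h l)) \<and> (\<forall>l\<in>{j..<card (edges m)}. b (h l) = c (x ` h l))}"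

text \<open>The set \<open>F\<close> of the overview: the images of the pattern edge
  \<open>h j\<close> when all other pattern vertices are placed by \<open>w\<close>.\<close>

definition fibre_edges ::
  "nat \<Rightarrow> nat \<Rightarrow> (nat \<Rightarrow> nat set) \<Rightarrow> colouring \<Rightarrow> template \<Rightarrow> colouring \<Rightarrow> nat \<Rightarrow> (nat \<Rightarrow> nat) \<Rightarrow> nat set set" where
  "fibre_edges m n h b t c j w =
     (\<lambda>x. x ` h j) ` {x \<in> hybrid_copies m n h b t c (Suc j). restrict x ({1..m} - h j) = w}"

definition edges_touching :: "nat \<Rightarrow> nat set \<Rightarrow> nat set set" where
  "edges_touching n R = {e \<in> edges n. e \<inter> R \<noteq> {}}"

section \<open>Embedded edges and hybrid copies\<close>

lemma edges_touching_subset: "edges_touching n R \<subseteq> edges n"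
  by (auto simp: edges_touching_def)

lemma finite_edges_touching [simp]: "finite (edges_touching n R)"
  by (simp add: edges_touching_def)

lemma card_edges_touching:
  assumes "finite R"
  shows "card (edges_touching n R) \<le> card R * n"
proof -
  have "edges_touching n R \<subseteq> (\<lambda>(u, v). {u, v}) ` (R \<times> {1..n})"
    by (auto simp: edges_touching_def edges_def nsets_2_eq image_iff)
  then have "card (edges_touching n R) \<le> card (R \<times> {1..n})"
    using assms by (intro surj_card_le) auto
  then show ?thesis
    by (simp add: card_cartesian_product)
qed

lemma finite_increasing_maps: "finite (increasing_maps m n)"
  unfolding increasing_maps_def by (rule finite_subset[OF _ finite_PiE[of "{1..m}" "\<lambda>_. {1..n}"]]) auto

lemma finite_hybrid_copies: "finite (hybrid_copies m n h b t c j)"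
  unfolding hybrid_copies_def using finite_increasing_maps by simp

lemma edge_subset: "e \<in> edges m \<Longrightarrow> e \<subseteq> {1..m}"
  by (auto simp: edges_def nsets_def)

lemma card_edge: "e \<in> edges m \<Longrightarrow> card e = 2"
  by (auto simp: edges_def nsets_def)

lemma increasing_map_edge:
  assumes "x \<in> increasing_maps m n" "e \<in> edges m"
  shows "x ` e \<in> edges n"
proof -
  have "inj_on x e"
    using assms edge_subset[OF assms(2)] strict_mono_on_imp_inj_on inj_on_subset
    unfolding increasing_maps_def by blast
  then have "card (x ` e) = 2"
    by (simp add: card_image card_edge[OF assms(2)])
  moreover from this have "finite (x ` e)"
    by (intro card_ge_0_finite) simp
  moreover have "x ` e \<subseteq> {1..n}"
    using assms(1) edge_subset[OF assms(2)] by (auto simp: increasing_maps_def)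
  ultimately show ?thesis
    by (simp add: edges_def nsets_def)
qed

text \<open>A copy of \<open>b\<close> in \<open>c\<close> would make \<open>b\<close> the
  restriction of \<open>c\<close> to the image of the copy, and heredity would put \<open>b\<close>
  into \<open>P m\<close>.\<close>

lemma hybrid_copies_zero:
  assumes "order_hereditary k P" "c \<in> P n" "b \<in> colourings k m" "b \<notin> P m"
    and "bij_betw h {..<card (edges m)} (edges m)"
  shows "hybrid_copies m n h b t c 0 = {}"
proof -
  have False if x: "x \<in> hybrid_copies m n h b t c 0" for x
  proof -
    have inc: "x \<in> {1..m} \<rightarrow>\<^sub>E {1..n}" "strict_mono_on {1..m} x"
      and eq: "\<And>l. l < card (edges m) \<Longrightarrow> b (h l) = c (x ` h l)"
      using x by (auto simp: hybrid_copies_def increasing_maps_def)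
    let ?A = "x ` {1..m}"
    have A: "?A \<subseteq> {1..n}" "card ?A = m"
      using inc(1) card_image[OF strict_mono_on_imp_inj_on[OF inc(2)]] by auto
    have "restriction c ?A = b"
    proof (rule PiE_ext[of _ "edges m" "\<lambda>_. UNIV"])
      show "restriction c ?A \<in> edges m \<rightarrow>\<^sub>E UNIV"
        unfolding restriction_def A by simp
      show "b \<in> edges m \<rightarrow>\<^sub>E UNIV"
        using assms(3) by (auto simp: colourings_def PiE_iff)
      fix e assume e: "e \<in> edges m"
      then obtain l where l: "l < card (edges m)" "e = h l"
        using assms(5) unfolding bij_betw_def by auto
      have "nth_vertex ?A ` e = x ` e"
        using edge_subset[OF e] nth_vertex_image[OF inc(2)] by (intro image_cong) auto
      then show "restriction c ?A e = b e"
        using restriction_apply[of e ?A c] e eq[OF l(1)] l(2) A(2) by simp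
    qed
    moreover have "restriction c ?A \<in> P (card ?A)"
      using assms(1,2) A(1) by (simp add: order_hereditary_def)
    ultimately show False
      using A(2) assms(4) by simp
  qed
  then show ?thesis
    by blast
qed

text \<open>The enumeration of \<open>A\<close> turns a bad pair \<open>(A, b)\<close> into a copy
  of the forbidden pattern \<open>b\<close> in \<open>t\<close>, and there are at most
  \<open>k ^ card (edges m)\<close> patterns.\<close>

lemma card_bad_pairs_le:
  assumes "t \<in> templates k n" "bij_betw h {..<card (edges m)} (edges m)"
    and "\<And>b. b \<in> colourings k m \<Longrightarrow> b \<notin> P m \<Longrightarrow>
      card (hybrid_copies m n h b t c (card (edges m))) \<le> \<mu>"
  shows "card (bad_pairs P m n t) \<le> k ^ card (edges m) * \<mu>"
proof -
  define D where "D b = (\<lambda>x. (x ` {1..m}, b)) ` hybrid_copies m n h b t c (card (edges m))" for b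
  have "bad_pairs P m n t \<subseteq> (\<Union>b\<in>colourings k m - P m. D b)"
  proof
    fix z assume "z \<in> bad_pairs P m n t"
    then obtain A b where z: "z = (A, b)" "A \<in> [{1..n}]\<^bsup>m\<^esup>"
        "b \<in> realisations m (restriction t A)" "b \<notin> P m"
      by (auto simp: bad_pairs_def)
    then have A: "A \<subseteq> {1..n}" "finite A" "card A = m"
      by (auto simp: nsets_def)
    have b: "b \<in> colourings k m"
      using realisations_subset_colourings[OF restriction_template[OF assms(1) A(1)]] z A by auto
    define x where "x = restrict (nth_vertex A) {1..m}"
    have bij: "bij_betw (nth_vertex A) {1..m} A"
      using bij_betw_nth_vertex[OF A(2)] A(3) by simp
    have "x ` {1..m} = A"
      using bij by (simp add: x_def bij_betw_def)
    moreover have "x \<in> increasing_maps m n"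
    proof -
      have "strict_mono_on {1..m} x"
        using nth_vertex_strict_mono[OF A(2)] A(3) by (auto simp: x_def strict_mono_on_def)
      moreover have "nth_vertex A i \<in> {1..n}" if "i \<in> {1..m}" for i
        using bij_betw_apply[OF bij that] A(1) by blast
      ultimately show ?thesis
        by (auto simp: increasing_maps_def x_def)
    qed
    moreover have "b (h l) \<in> t (x ` h l)" if l: "l < card (edges m)" for l
    proof -
      have hl: "h l \<in> edges m"
        using l assms(2) bij_betwE by blast
      then have "x ` h l = nth_vertex A ` h l"
        using edge_subset[OF hl] by (intro image_cong) (auto simp: x_def)
      then show ?thesis
        using realisation_mem[OF z(3) hl] restriction_apply[of "h l" A t] hl A(3) by simp
    qed
    ultimately have "x \<in> hybrid_copies m n h b t c (card (edges m))" "x ` {1..m} = A"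
      by (auto simp: hybrid_copies_def)
    then show "z \<in> (\<Union>b\<in>colourings k m - P m. D b)"
      using z b by (auto simp: D_def image_iff intro!: bexI[of _ b] bexI[of _ x])
  qed
  then have "card (bad_pairs P m n t) \<le> card (\<Union>b\<in>colourings k m - P m. D b)"
    using finite_colourings finite_hybrid_copies by (intro card_mono) (auto simp: D_def)
  also have "\<dots> \<le> (\<Sum>b\<in>colourings k m - P m. card (D b))"
    using finite_colourings by (intro card_UN_le) auto
  also have "\<dots> \<le> (\<Sum>b\<in>colourings k m - P m. \<mu>)"
  proof (rule sum_mono)
    fix b assume "b \<in> colourings k m - P m"
    then show "card (D b) \<le> \<mu>"
      using assms(3)[of b] card_image_le[OF finite_hybrid_copies] unfolding D_def
      by (meson DiffE le_trans)
  qed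
  also have "\<dots> \<le> card (colourings k m) * \<mu>"
    using finite_colourings by (simp add: card_mono)
  also have "card (colourings k m) = k ^ card (edges m)"
    by (simp add: colourings_def card_PiE)
  finally show ?thesis .
qed

text \<open>Since \<open>c\<close> realises \<open>t\<close>, agreeing with \<open>c\<close> at an
  edge is stronger than being allowed there by \<open>t\<close>.\<close>

lemma hybrid_copies_mono:
  assumes "c \<in> realisations n t" "bij_betw h {..<card (edges m)} (edges m)" "j < card (edges m)"
  shows "hybrid_copies m n h b t c j \<subseteq> hybrid_copies m n h b t c (Suc j)"
proof
  fix x assume x: "x \<in> hybrid_copies m n h b t c j"
  have "h j \<in> edges m"
    using assms(2,3) bij_betwE by blast
  then have "x ` h j \<in> edges n"
    using x increasing_map_edge by (auto simp: hybrid_copies_def)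
  then have "c (x ` h j) \<in> t (x ` h j)"
    using realisation_mem[OF assms(1)] by blast
  moreover have "b (h j) = c (x ` h j)"
    using x assms(3) by (auto simp: hybrid_copies_def)
  ultimately show "x \<in> hybrid_copies m n h b t c (Suc j)"
    using x by (auto simp: hybrid_copies_def less_Suc_eq)
qed

text \<open>
  Every edge of the pattern other than \<open>h j\<close> has an endpoint outside \<open>h j\<close>, so \<open>x\<close> maps it to
  an edge that touches the image of \<open>w\<close>. This is why few bits suffice to describe the set.
\<close>

lemma fibre_edges_restrict:
  assumes "bij_betw h {..<card (edges m)} (edges m)" "j < card (edges m)"
  shows "fibre_edges m n h b t (restrict c (edges_touching n (w ` ({1..m} - h j)))) j w
    = fibre_edges m n h b t c j w"
proof -
  let ?Q = "{1..m} - h j"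
  define d where "d = restrict c (edges_touching n (w ` ?Q))"
  have d: "d (x ` h l) = c (x ` h l)"
    if x: "x \<in> increasing_maps m n" "restrict x ?Q = w" and l: "l \<in> {Suc j..<card (edges m)}" for x l
  proof -
    have h: "h l \<in> edges m" "h j \<in> edges m" "h l \<noteq> h j"
      using assms l bij_betwE[OF assms(1)] inj_on_eq_iff[OF bij_betw_imp_inj_on[OF assms(1)]] by auto
    have "\<not> h l \<subseteq> h j"
      using h card_edge[OF h(1)] card_edge[OF h(2)] card_subset_eq[of "h j" "h l"]
      by (metis card_ge_0_finite zero_less_numeral)
    then obtain y where y: "y \<in> h l" "y \<in> ?Q"
      using edge_subset[OF h(1)] by blast
    then have "x y = w y"
      using x(2) by auto
    then have "x ` h l \<in> edges_touching n (w ` ?Q)"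
      using y increasing_map_edge[OF x(1) h(1)] by (auto simp: edges_touching_def)
    then show ?thesis
      by (simp add: d_def)
  qed
  have "x \<in> hybrid_copies m n h b t d (Suc j) \<longleftrightarrow> x \<in> hybrid_copies m n h b t c (Suc j)"
    if "restrict x ?Q = w" for x
    using d[OF _ that] unfolding hybrid_copies_def by fastforce
  then have "{x \<in> hybrid_copies m n h b t d (Suc j). restrict x ?Q = w}
      = {x \<in> hybrid_copies m n h b t c (Suc j). restrict x ?Q = w}"
    by blast
  then show ?thesis
    unfolding fibre_edges_def d_def by simp
qed

section \<open>Copies with all vertices outside one pattern edge fixed\<close>

lemma inj_on_fibre:
  assumes "h j \<in> edges m"
  shows "inj_on (\<lambda>x. x ` h j) {x \<in> increasing_maps m n. restrict x ({1..m} - h j) = w}"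
proof (rule inj_onI)
  fix x y
  assume x: "x \<in> {x \<in> increasing_maps m n. restrict x ({1..m} - h j) = w}"
    and y: "y \<in> {x \<in> increasing_maps m n. restrict x ({1..m} - h j) = w}"
    and eq: "x ` h j = y ` h j"
  obtain a a' where a: "h j = {a, a'}" "a < a'" "{a, a'} \<subseteq> {1..m}"
    using assms unfolding edges_def nsets_def card_2_iff
    by clarify (metis insert_commute linorder_neq_iff)
  have mono: "strict_mono_on {1..m} x" "strict_mono_on {1..m} y"
    and PiE: "x \<in> {1..m} \<rightarrow>\<^sub>E {1..n}" "y \<in> {1..m} \<rightarrow>\<^sub>E {1..n}"
    using x y by (auto simp: increasing_maps_def)
  \<comment> \<open>Monotonicity decides which endpoint goes where, so the image of the edge
    determines both missing values. Counting copies in a fibre is thus counting edges.\<close>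
  have "x a < x a'" "y a < y a'"
    using a mono by (auto intro: strict_mono_onD)
  then have aa: "x a = y a" "x a' = y a'"
    using eq a by (auto simp: doubleton_eq_iff)
  show "x = y"
  proof (rule PiE_ext[OF PiE])
    fix i assume i: "i \<in> {1..m}"
    show "x i = y i"
    proof (cases "i \<in> h j")
      case True
      then show ?thesis
        using aa a by auto
    next
      case False
      have "restrict x ({1..m} - h j) i = restrict y ({1..m} - h j) i"
        using x y by simp
      then show ?thesis
        using i False by simp
    qed
  qed
qed

lemma fibre_edges_props:
  assumes "h j \<in> edges m"
  shows "fibre_edges m n h b t c j w \<subseteq> edges n"
    and "f \<in> fibre_edges m n h b t c j w \<Longrightarrow> b (h j) \<in> t f"
    and "card (fibre_edges m n h b t c j w)
      = card {x \<in> hybrid_copies m n h b t c (Suc j). restrict x ({1..m} - h j) = w}"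
    and "card {f \<in> fibre_edges m n h b t c j w. c f = b (h j)}
      \<le> card {x \<in> hybrid_copies m n h b t c j. restrict x ({1..m} - h j) = w}"
proof -
  show "fibre_edges m n h b t c j w \<subseteq> edges n"
    using increasing_map_edge[OF _ assms] by (auto simp: fibre_edges_def hybrid_copies_def)
  show "f \<in> fibre_edges m n h b t c j w \<Longrightarrow> b (h j) \<in> t f"
    by (auto simp: fibre_edges_def hybrid_copies_def)
  show "card (fibre_edges m n h b t c j w)
      = card {x \<in> hybrid_copies m n h b t c (Suc j). restrict x ({1..m} - h j) = w}"
    unfolding fibre_edges_def
    by (rule card_image, rule inj_on_subset[OF inj_on_fibre[of h j m n w, OF assms]])
      (auto simp: hybrid_copies_def)
  \<comment> \<open>If \<open>c\<close> already has the colour \<open>b (h j)\<close> at the image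
    of \<open>h j\<close>, the copy counted at stage \<open>Suc j\<close> is also one at stage
    \<open>j\<close>. So few copies at stage \<open>j\<close> mean few edges of this colour.\<close>
  have "x \<in> hybrid_copies m n h b t c j"
    if "x \<in> hybrid_copies m n h b t c (Suc j)" "c (x ` h j) = b (h j)" for x
  proof -
    have "b (h l) = c (x ` h l)" if "l \<in> {j..<card (edges m)}" for l
      using that \<open>x \<in> _\<close> \<open>c (x ` h j) = _\<close>
      by (cases "l = j") (auto simp: hybrid_copies_def)
    then show ?thesis
      using that(1) by (auto simp: hybrid_copies_def)
  qed
  then have "{f \<in> fibre_edges m n h b t c j w. c f = b (h j)}
      \<subseteq> (\<lambda>x. x ` h j) ` {x \<in> hybrid_copies m n h b t c j. restrict x ({1..m} - h j) = w}"
    by (auto simp: fibre_edges_def)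
  then show "card {f \<in> fibre_edges m n h b t c j w. c f = b (h j)}
      \<le> card {x \<in> hybrid_copies m n h b t c j. restrict x ({1..m} - h j) = w}"
    using finite_hybrid_copies by (intro surj_card_le) auto
qed

text \<open>Pigeonhole yields one forbidden pattern with many copies in \<open>t\<close>; the count
  is 0 at stage 0, so some stage has a jump by a factor \<open>\<mu>\<close> plus a dense surplus;
  averaging over the placements \<open>w\<close> finds a fibre with the same jump.\<close>

lemma rich_fibre_edges:
  fixes \<mu> \<delta> :: real
  assumes "k > 0" "order_hereditary k P" "2 \<le> m" "\<mu> \<ge> 1" "\<delta> > 0"
    and h: "bij_betw h {..<card (edges m)} (edges m)"
  shows "\<exists>\<gamma>>0. \<forall>n\<ge>m. \<forall>t\<in>templates k n. \<forall>c\<in>P n \<inter> realisations n t.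
      real (card (bad_pairs P m n t)) > \<delta> * real (n choose m) \<longrightarrow>
      (\<exists>b\<in>colourings k m. \<exists>j<card (edges m). \<exists>w\<in>({1..m} - h j) \<rightarrow>\<^sub>E {1..n}.
        \<gamma> * real n ^ 2 \<le> card (fibre_edges m n h b t c j w) \<and>
        \<mu> * card {f \<in> fibre_edges m n h b t c j w. c f = b (h j)} \<le> card (fibre_edges m n h b t c j w))"
proof -
  define r where "r = card (edges m)"
  have r: "r > 0"
    using assms(3) by (simp add: r_def card_edges zero_less_binomial)
  define K where "K = real k ^ r"
  have K: "K > 0"
    using assms(1) by (simp add: K_def)
  \<comment> \<open>Chosen so that \<open>r * (\<gamma> * real n ^ m) * \<mu> ^ r\<close> equals
    \<open>\<delta> * (n / m) ^ m / K\<close>, which is at most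
    \<open>\<delta> * (n choose m) / K\<close>, the guaranteed number of copies of some
    pattern.\<close>
  define \<gamma> where "\<gamma> = \<delta> / (K * real m ^ m * r * \<mu> ^ r)"
  have \<gamma>: "\<gamma> > 0"
    using assms(3-5) K r by (simp add: \<gamma>_def)
  have \<gamma>_eq: "r * \<gamma> * \<mu> ^ r = \<delta> / (K * real m ^ m)"
    using assms(3-5) K r by (simp add: \<gamma>_def field_simps)
  have "\<exists>b\<in>colourings k m. \<exists>j<r. \<exists>w\<in>({1..m} - h j) \<rightarrow>\<^sub>E {1..n}.
        \<gamma> * real n ^ 2 \<le> card (fibre_edges m n h b t c j w) \<and>
        \<mu> * card {f \<in> fibre_edges m n h b t c j w. c f = b (h j)} \<le> card (fibre_edges m n h b t c j w)"
    if n: "m \<le> n" and t: "t \<in> templates k n" and c: "c \<in> P n" "c \<in> realisations n t"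
      and bad: "real (card (bad_pairs P m n t)) > \<delta> * real (n choose m)" for n t c
  proof -
    define M where "M = nat \<lfloor>\<delta> * real (n choose m) / K\<rfloor>"
    have "\<exists>b\<in>colourings k m. b \<notin> P m \<and> \<not> card (hybrid_copies m n h b t c r) \<le> M"
    proof (rule ccontr)
      assume "\<not> ?thesis"
      then have "card (bad_pairs P m n t) \<le> k ^ r * M"
        unfolding r_def by (intro card_bad_pairs_le[OF t h]) blast
      then have "real (card (bad_pairs P m n t)) \<le> real (k ^ r * M)"
        by (rule of_nat_mono)
      also have "\<dots> = K * M"
        by (simp add: K_def)
      also have "\<dots> \<le> K * (\<delta> * real (n choose m) / K)"
        using K assms(5) unfolding M_def by (intro mult_left_mono of_nat_floor) auto
      finally show False
        using bad K by simp
    qed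
    then obtain b where b: "b \<in> colourings k m" "b \<notin> P m"
        "M < card (hybrid_copies m n h b t c r)"
      by auto
    define a where "a j = real (card (hybrid_copies m n h b t c j))" for j
    have "r * (\<gamma> * real n ^ m) * \<mu> ^ r = (r * \<gamma> * \<mu> ^ r) * real n ^ m"
      by simp
    also have "\<dots> = \<delta> * (real n / real m) ^ m / K"
      unfolding \<gamma>_eq by (simp add: power_divide)
    also have "\<dots> \<le> \<delta> * real (n choose m) / K"
      using K assms(5) binomial_ge_n_over_k_pow_k[OF n, where 'a = real]
      by (intro divide_right_mono mult_left_mono) auto
    also have "\<dots> < a r"
      using b(3) unfolding M_def a_def by linarith
    finally have "a r > r * (\<gamma> * real n ^ m) * \<mu> ^ r" .
    moreover have "a 0 = 0"
      using hybrid_copies_zero[OF assms(2) c(1) b(1,2) h] by (simp add: a_def)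
    ultimately obtain j where j: "j < r" "a (Suc j) \<ge> \<mu> * a j + \<gamma> * real n ^ m"
      using exists_large_increment[of a \<mu> "\<gamma> * real n ^ m" r] assms(4) \<gamma> by auto
    have hj: "h j \<in> edges m"
      using h j(1) bij_betwE unfolding r_def by blast
    let ?W = "({1..m} - h j) \<rightarrow>\<^sub>E {1..n}" and ?\<phi> = "\<lambda>x. restrict x ({1..m} - h j)"
    have "card ({1..m} - h j) = m - 2"
      using card_edge[OF hj] edge_subset[OF hj] by (simp add: card_Diff_subset finite_subset)
    then have "card ?W = n ^ (m - 2)"
      by (simp add: card_PiE)
    \<comment> \<open>There are \<open>n ^ (m - 2)\<close> fibres, so a surplus of order
      \<open>n ^ m\<close> leaves one of order \<open>n ^ 2\<close> on average.\<close>
    moreover have "real n ^ m = real n ^ 2 * real n ^ (m - 2)"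
      using assms(3) by (simp only: power_add[symmetric] le_add_diff_inverse)
    ultimately have "a (Suc j) \<ge> \<mu> * a j + (\<gamma> * real n ^ 2) * card ?W"
      using j(2) by (simp add: mult.assoc)
    then have card_X: "card (hybrid_copies m n h b t c (Suc j))
        \<ge> \<mu> * card (hybrid_copies m n h b t c j) + (\<gamma> * real n ^ 2) * card ?W"
      by (simp only: a_def)
    have im: "?\<phi> ` hybrid_copies m n h b t c (Suc j) \<subseteq> ?W"
      by (intro image_subsetI, subst restrict_PiE_iff)
        (auto simp: hybrid_copies_def increasing_maps_def)
    have W: "finite ?W" "?W \<noteq> {}"
      using n assms(3) by (auto intro!: finite_PiE simp: PiE_eq_empty_iff)
    have "\<exists>w\<in>?W. card {x \<in> hybrid_copies m n h b t c (Suc j). ?\<phi> x = w}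
        \<ge> \<mu> * card {x \<in> hybrid_copies m n h b t c j. ?\<phi> x = w} + \<gamma> * real n ^ 2"
      using j(1) by (intro exists_rich_fibre finite_hybrid_copies W im card_X
          hybrid_copies_mono[OF c(2) h]) (simp add: r_def)
    then obtain w where w: "w \<in> ?W"
      "real (card (fibre_edges m n h b t c j w))
        \<ge> \<mu> * card {x \<in> hybrid_copies m n h b t c j. ?\<phi> x = w} + \<gamma> * real n ^ 2"
      unfolding fibre_edges_props(3)[of h j m n b t c, OF hj, symmetric] by (elim bexE)
    have "\<gamma> * real n ^ 2 \<ge> 0"
      using \<gamma> by simp
    moreover have "\<mu> * card {f \<in> fibre_edges m n h b t c j w. c f = b (h j)}
        \<le> \<mu> * card {x \<in> hybrid_copies m n h b t c j. ?\<phi> x = w}"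
      using fibre_edges_props(4)[of h j m n b t c w, OF hj] assms(4) by (intro mult_left_mono) auto
    moreover have "\<mu> * card {x \<in> hybrid_copies m n h b t c j. ?\<phi> x = w} \<ge> 0"
      using assms(4) by simp
    ultimately have "\<gamma> * real n ^ 2 \<le> card (fibre_edges m n h b t c j w) \<and>
        \<mu> * card {f \<in> fibre_edges m n h b t c j w. c f = b (h j)} \<le> card (fibre_edges m n h b t c j w)"
      using w(2) by linarith
    then show ?thesis
      using w(1) b(1) j(1) by blast
  qed
  then show ?thesis
    using \<gamma> unfolding r_def by (intro exI[of _ \<gamma>]) blast
qed

section \<open>Deleting a colour on a set of edges, and counting fingerprints\<close>

definition remove_colour :: "nat \<Rightarrow> template \<Rightarrow> nat \<Rightarrow> nat set set \<Rightarrow> template" where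
  "remove_colour n t i G = (\<lambda>e\<in>edges n. if e \<in> G then t e - {i} else t e)"

lemma weight_remove_colour:
  assumes "t \<in> templates k n" "G \<subseteq> edges n" "\<And>f. f \<in> G \<Longrightarrow> i \<in> t f"
  shows "weight n (remove_colour n t i G) + card G = weight n t"
proof -
  have "card (t e) = card (remove_colour n t i G e) + (if e \<in> G then 1 else 0)"
    if e: "e \<in> edges n" for e
  proof (cases "e \<in> G")
    case True
    then have "card (t e) = Suc (card (t e - {i}))"
      using card.remove[OF finite_template[OF assms(1) e] assms(3)] by blast
    then show ?thesis
      using True e by (simp only: remove_colour_def restrict_apply if_True)
  qed (use e in \<open>simp add: remove_colour_def\<close>)
  then have "weight n t
      = (\<Sum>e\<in>edges n. card (remove_colour n t i G e) + (if e \<in> G then 1 else 0))"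
    unfolding weight_def by (intro sum.cong) auto
  also have "\<dots> = weight n (remove_colour n t i G) + (\<Sum>e\<in>edges n. if e \<in> G then 1 else 0)"
    by (simp add: weight_def sum.distrib)
  also have "(\<Sum>e\<in>edges n. if e \<in> G then 1 else 0) = card G"
    using assms(2) by (simp add: sum.If_cases Int_absorb1)
  finally show ?thesis ..
qed

lemma realisation_remove_colour:
  assumes "c \<in> realisations n t" "\<And>f. f \<in> G \<Longrightarrow> c f \<noteq> i"
  shows "c \<in> realisations n (remove_colour n t i G)"
  using assms unfolding realisations_def by (auto simp: remove_colour_def PiE_iff)

text \<open>Deletion might empty the list of some edge; a realisation \<open>c\<close> of the result
  rules this out.\<close>

lemma remove_colour_template:
  assumes "t \<in> templates k n" "c \<in> realisations n (remove_colour n t i G)"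
  shows "remove_colour n t i G \<in> templates k n"
  unfolding templates_def
proof (rule PiE_I)
  fix e assume e: "e \<in> edges n"
  show "remove_colour n t i G e \<in> {X. X \<subseteq> {1..k} \<and> X \<noteq> {}}"
    using template_subset[OF assms(1) e] realisation_mem[OF assms(2) e] e
    by (auto simp: remove_colour_def split: if_splits)
qed (simp add: remove_colour_def)

text \<open>
  Candidates for the colour \<open>b p\<close> and the set \<open>F\<close> of the introduction, as \<open>c\<close> varies: only the
  restriction \<open>d\<close> of \<open>c\<close> to the edges touching \<open>w\<close> matters.
\<close>

definition fingerprints ::
  "nat \<Rightarrow> nat \<Rightarrow> nat \<Rightarrow> (nat \<Rightarrow> nat set) \<Rightarrow> template \<Rightarrow> (nat \<times> nat set set) set" where
  "fingerprints k m n h t =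
     (\<lambda>(b, j, w, d). (b (h j), fibre_edges m n h b t d j w)) `
       (SIGMA b:colourings k m. SIGMA j:{..<card (edges m)}. SIGMA w:({1..m} - h j) \<rightarrow>\<^sub>E {1..n}.
          edges_touching n (w ` ({1..m} - h j)) \<rightarrow>\<^sub>E {1..k})"

lemma card_Sigma_le:
  assumes "finite A \<and> card A \<le> M" "\<And>a. a \<in> A \<Longrightarrow> finite (B a) \<and> card (B a) \<le> N"
  shows "finite (Sigma A B) \<and> card (Sigma A B) \<le> M * N"
proof -
  have "card (Sigma A B) = (\<Sum>a\<in>A. card (B a))"
    using assms by (simp add: card_SigmaI)
  also have "\<dots> \<le> (\<Sum>a\<in>A. N)"
    using assms(2) by (intro sum_mono) blast
  also have "\<dots> \<le> M * N"
    using assms(1) by simp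
  finally show ?thesis
    using assms by blast
qed

lemma card_PiE_atLeastAtMost_le:
  assumes "finite I" "card I \<le> M" "n > 0"
  shows "finite (I \<rightarrow>\<^sub>E {1..n}) \<and> card (I \<rightarrow>\<^sub>E {1..n}) \<le> n ^ M"
  using assms by (simp add: card_PiE finite_PiE power_increasing)

text \<open>The image of \<open>w\<close> has at most \<open>m\<close> vertices and touches at most
  \<open>m * n\<close> edges, so the dominant factor \<open>k ^ (m * n)\<close> has an exponent only
  linear in \<open>n\<close>.\<close>

lemma card_fingerprints:
  assumes "k > 0" "n > 0"
  shows "finite (fingerprints k m n h t) \<and> card (fingerprints k m n h t)
    \<le> k ^ card (edges m) * (card (edges m) * (n ^ m * k ^ (m * n)))"
proof -
  have Q: "finite ({1..m} - h j)" "card ({1..m} - h j) \<le> m" for j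
    using card_mono[of "{1..m}" "{1..m} - h j"] by auto
  have E: "card (edges_touching n (w ` ({1..m} - h j))) \<le> m * n" for w j
  proof -
    have "card (edges_touching n (w ` ({1..m} - h j))) \<le> card (w ` ({1..m} - h j)) * n"
      using Q(1) by (intro card_edges_touching finite_imageI)
    also have "\<dots> \<le> m * n"
      by (rule mult_le_mono1[OF le_trans[OF card_image_le[OF Q(1)] Q(2)]])
    finally show ?thesis .
  qed
  have "finite (SIGMA b:colourings k m. SIGMA j:{..<card (edges m)}. SIGMA w:({1..m} - h j) \<rightarrow>\<^sub>E {1..n}.
        edges_touching n (w ` ({1..m} - h j)) \<rightarrow>\<^sub>E {1..k}) \<and>
      card (SIGMA b:colourings k m. SIGMA j:{..<card (edges m)}. SIGMA w:({1..m} - h j) \<rightarrow>\<^sub>E {1..n}.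
        edges_touching n (w ` ({1..m} - h j)) \<rightarrow>\<^sub>E {1..k})
      \<le> k ^ card (edges m) * (card (edges m) * (n ^ m * k ^ (m * n)))" (is "finite ?I \<and> _")
    unfolding colourings_def using assms Q E
    by (intro card_Sigma_le card_PiE_atLeastAtMost_le) simp_all
  moreover from this have "card (fingerprints k m n h t) \<le> card ?I"
    unfolding fingerprints_def by (intro card_image_le) blast
  ultimately show ?thesis
    unfolding fingerprints_def by (intro conjI finite_imageI) linarith+
qed

lemma card_fingerprints_exp:
  fixes c :: real
  assumes "k > 0" "c > 0"
  shows "\<exists>n\<^sub>0. \<forall>n\<ge>n\<^sub>0. \<forall>h t. real (card (fingerprints k m n h t)) \<le> exp (c * real n ^ 2)"
proof -
  define K where "K = real k ^ card (edges m) * card (edges m)"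
  define b where "b = m + m * ln k"
  obtain n\<^sub>0 where n\<^sub>0: "\<And>n. n \<ge> n\<^sub>0 \<Longrightarrow> K * exp (b * real n) \<le> exp (c * real n ^ 2)"
    using exp_linear_le_exp_quadratic[OF assms(2)] by blast
  have "real (card (fingerprints k m n h t)) \<le> exp (c * real n ^ 2)" if n: "n \<ge> max n\<^sub>0 1" for n h t
  proof -
    have "real n ^ m \<le> exp (real n) ^ m"
      using exp_ge_add_one_self[of "real n"] by (intro power_mono) linarith+
    moreover have "real k ^ (m * n) = exp (m * ln k * n)"
      using assms(1) exp_of_nat_mult[of "m * n" "ln k"] by (simp add: mult_ac)
    ultimately have "real n ^ m * real k ^ (m * n) \<le> exp (b * n)"
      by (simp add: b_def distrib_right exp_add exp_of_nat_mult)
    then have "K * (real n ^ m * real k ^ (m * n)) \<le> K * exp (b * n)"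
      unfolding K_def by (intro mult_left_mono) auto
    moreover have "real (card (fingerprints k m n h t)) \<le> K * (real n ^ m * real k ^ (m * n))"
    proof -
      have "card (fingerprints k m n h t) \<le> k ^ card (edges m) * (card (edges m) * (n ^ m * k ^ (m * n)))"
        using card_fingerprints[of k n m h t] assms n by auto
      then have "real (card (fingerprints k m n h t))
          \<le> real (k ^ card (edges m) * (card (edges m) * (n ^ m * k ^ (m * n))))"
        by (rule of_nat_mono)
      then show ?thesis
        by (simp add: K_def mult.assoc)
    qed
    ultimately show ?thesis
      using n\<^sub>0[of n] n by simp
  qed
  then show ?thesis
    by blast
qed

section \<open>The container lemma\<close>

lemma bad_pairs_empty:
  assumes "order_hereditary k P" "P m \<noteq> {}" "m < 2"
  shows "bad_pairs P m n t = {}"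
proof -
  have "card (edges m) = 0"
    using assms(3) by (simp add: card_edges)
  then have "edges m = {}"
    by simp
  then have "colourings k m = {\<lambda>_. undefined}" "\<And>s. realisations m s = {\<lambda>_. undefined}"
    by (simp_all add: colourings_def realisations_def)
  moreover have "P m \<subseteq> colourings k m"
    using assms(1) by (simp add: order_hereditary_def)
  ultimately show ?thesis
    using assms(2) by (auto simp: bad_pairs_def)
qed

text \<open>For a fingerprint \<open>(i, F)\<close> with \<open>F\<close> dense, guess the small set
  \<open>Y\<close> of edges of \<open>F\<close> where \<open>c\<close> has colour \<open>i\<close>,
  and delete \<open>i\<close> on \<open>F - Y\<close>. The weight loss gains
  \<open>exp (- \<beta> * card F)\<close>, and summing over \<open>Y\<close> costs only
  \<open>exp (\<beta> / 2 * card F)\<close>. The remaining gain is at least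
  \<open>exp (\<beta> / 2 * \<gamma> * n\<^sup>2)\<close> and pays for the number of
  fingerprints.\<close>

lemma container_step:
  fixes \<beta> \<delta> :: real
  assumes "k > 0" "order_hereditary k P" "2 \<le> m" "\<beta> > 0" "\<delta> > 0"
  shows "\<exists>n\<^sub>0. \<forall>n\<ge>n\<^sub>0. \<forall>t\<in>templates k n.
      real (card (bad_pairs P m n t)) > \<delta> * real (n choose m) \<longrightarrow>
      (\<exists>T\<subseteq>templates k n. P n \<inter> realisations n t \<subseteq> (\<Union>s\<in>T. realisations n s) \<and>
        (\<forall>s\<in>T. weight n s < weight n t) \<and>
        (\<Sum>s\<in>T. exp (\<beta> * weight n s)) \<le> exp (\<beta> * weight n t))"
proof -
  obtain \<theta> :: real where \<theta>: "0 < \<theta>" "\<theta> < 1"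
    and small: "\<And>F :: nat set set. finite F \<Longrightarrow>
      (\<Sum>Y | Y \<subseteq> F \<and> real (card Y) \<le> \<theta> * card F. exp (\<beta> * card Y)) \<le> exp (\<beta> / 2 * card F)"
    using small_subsets_sum[OF assms(4), where 'a = "nat set"] by blast
  obtain h where h: "bij_betw h {..<card (edges m)} (edges m)"
    using ex_bij_betw_nat_finite[OF finite_edges] by (auto simp: atLeast0LessThan)
  \<comment> \<open>The jump factor is \<open>1 / \<theta>\<close>, so that the exceptional set has
    at most \<open>\<theta> * card F\<close> elements.\<close>
  have "1 / \<theta> \<ge> 1"
    using \<theta> by simp
  then have "\<exists>\<gamma>>0. \<forall>n\<ge>m. \<forall>t\<in>templates k n. \<forall>c\<in>P n \<inter> realisations n t.
      real (card (bad_pairs P m n t)) > \<delta> * real (n choose m) \<longrightarrow>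
      (\<exists>b\<in>colourings k m. \<exists>j<card (edges m). \<exists>w\<in>({1..m} - h j) \<rightarrow>\<^sub>E {1..n}.
        \<gamma> * real n ^ 2 \<le> card (fibre_edges m n h b t c j w) \<and>
        1 / \<theta> * card {f \<in> fibre_edges m n h b t c j w. c f = b (h j)}
          \<le> card (fibre_edges m n h b t c j w))"
    by (rule rich_fibre_edges[OF assms(1-3) _ assms(5) h])
  then obtain \<gamma> :: real where \<gamma>: "\<gamma> > 0" and rich: "\<forall>n\<ge>m. \<forall>t\<in>templates k n. \<forall>c\<in>P n \<inter> realisations n t.
      real (card (bad_pairs P m n t)) > \<delta> * real (n choose m) \<longrightarrow>
      (\<exists>b\<in>colourings k m. \<exists>j<card (edges m). \<exists>w\<in>({1..m} - h j) \<rightarrow>\<^sub>E {1..n}.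
        \<gamma> * real n ^ 2 \<le> card (fibre_edges m n h b t c j w) \<and>
        1 / \<theta> * card {f \<in> fibre_edges m n h b t c j w. c f = b (h j)}
          \<le> card (fibre_edges m n h b t c j w))"
    by (elim exE conjE)
  have "\<beta> / 2 * \<gamma> > 0"
    using assms(4) \<gamma> by simp
  from card_fingerprints_exp[OF assms(1) this] obtain n\<^sub>1 where n\<^sub>1:
    "\<And>n h t. n \<ge> n\<^sub>1 \<Longrightarrow> real (card (fingerprints k m n h t)) \<le> exp (\<beta> / 2 * \<gamma> * real n ^ 2)"
    by blast
  have "\<exists>T\<subseteq>templates k n. P n \<inter> realisations n t \<subseteq> (\<Union>s\<in>T. realisations n s) \<and>
        (\<forall>s\<in>T. weight n s < weight n t) \<and>
        (\<Sum>s\<in>T. exp (\<beta> * weight n s)) \<le> exp (\<beta> * weight n t)"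
    if n: "n \<ge> max n\<^sub>1 m" and t: "t \<in> templates k n"
      and bad: "real (card (bad_pairs P m n t)) > \<delta> * real (n choose m)" for n t
  proof -
    define \<Phi> where "\<Phi> = {p \<in> fingerprints k m n h t.
      snd p \<subseteq> edges n \<and> (\<forall>f\<in>snd p. fst p \<in> t f) \<and> \<gamma> * real n ^ 2 \<le> card (snd p)}"
    define small where "small F = {Y. Y \<subseteq> F \<and> real (card Y) \<le> \<theta> * card F}" for F :: "nat set set"
    define I where "I = (SIGMA p:\<Phi>. small (snd p))"
    define g where "g = (\<lambda>(p, Y). remove_colour n t (fst p) (snd p - Y))"
    \<comment> \<open>The intersection discards results with an empty list; these have no
      realisations, so the covering is not affected.\<close>
    define T where "T = g ` I \<inter> templates k n"
    have n_pos: "n > 0"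
      using n assms(3) by simp
    have fin_fp: "finite (fingerprints k m n h t)"
      using card_fingerprints[OF assms(1) n_pos] by blast
    have fin_\<Phi>: "finite \<Phi>"
      using fin_fp by (simp add: \<Phi>_def)
    have \<Phi>: "snd p \<subseteq> edges n" "finite (snd p)" "\<And>f. f \<in> snd p \<Longrightarrow> fst p \<in> t f"
      "\<gamma> * real n ^ 2 \<le> card (snd p)" if "p \<in> \<Phi>" for p
      using that finite_subset[OF _ finite_edges] by (auto simp: \<Phi>_def)
    have fin_small: "finite (small F)" if "finite F" for F
      using that by (simp add: small_def)
    have fin_I: "finite I"
      unfolding I_def using fin_\<Phi> fin_small \<Phi>(2) by blast
    have weight_g: "real (weight n (g (p, Y))) = real (weight n t) - card (snd p) + card Y"
      if "p \<in> \<Phi>" "Y \<subseteq> snd p" for p Y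
    proof -
      have "weight n (g (p, Y)) + card (snd p - Y) = weight n t"
        unfolding g_def prod.case using \<Phi>(1,3)[OF that(1)]
        by (intro weight_remove_colour[OF t]) auto
      moreover have "card (snd p - Y) + card Y = card (snd p)"
        using that(2) \<Phi>(2)[OF that(1)] finite_subset[OF that(2)]
        by (simp add: card_Diff_subset card_mono)
      ultimately show ?thesis
        by linarith
    qed
    have "weight n s < weight n t" if s: "s \<in> T" for s
    proof -
      obtain p Y where pY: "p \<in> \<Phi>" "Y \<subseteq> snd p" "real (card Y) \<le> \<theta> * card (snd p)" "s = g (p, Y)"
        using s by (auto simp: T_def I_def small_def)
      have "0 < real (card (snd p))"
        using \<Phi>(4)[OF pY(1)] \<gamma> n_pos by (smt (verit) mult_pos_pos of_nat_0_less_iff zero_less_power)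
      then have "\<theta> * card (snd p) < card (snd p)"
        using \<theta>(2) by simp
      then show ?thesis
        using weight_g[OF pY(1,2)] pY(3,4) by simp
    qed
    moreover have "(\<Sum>s\<in>T. exp (\<beta> * weight n s)) \<le> exp (\<beta> * weight n t)"
    proof -
      have "(\<Sum>s\<in>T. exp (\<beta> * weight n s)) \<le> (\<Sum>s\<in>g ` I. exp (\<beta> * weight n s))"
        unfolding T_def using fin_I by (intro sum_mono2) auto
      \<comment> \<open>Different choices may give the same template, so passing to the index set
        \<open>I\<close> can only increase the sum.\<close>
      also have "\<dots> \<le> (\<Sum>z\<in>I. exp (\<beta> * weight n (g z)))"
        using sum_image_le[OF fin_I, of "\<lambda>s. exp (\<beta> * weight n s)" g] by (simp add: comp_def)
      also have "\<dots> = (\<Sum>p\<in>\<Phi>. \<Sum>Y\<in>small (snd p). exp (\<beta> * weight n (g (p, Y))))"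
        unfolding I_def using fin_\<Phi> fin_small \<Phi>(2) by (subst sum.Sigma) auto
      also have "\<dots> \<le> (\<Sum>p\<in>\<Phi>. exp (\<beta> * weight n t - \<beta> / 2 * \<gamma> * real n ^ 2))"
      proof (rule sum_mono)
        fix p assume p: "p \<in> \<Phi>"
        have "(\<Sum>Y\<in>small (snd p). exp (\<beta> * weight n (g (p, Y))))
            = exp (\<beta> * (real (weight n t) - card (snd p))) * (\<Sum>Y\<in>small (snd p). exp (\<beta> * card Y))"
          unfolding sum_distrib_left using weight_g[OF p]
          by (intro sum.cong) (auto simp: small_def distrib_left simp flip: exp_add)
        also have "\<dots> \<le> exp (\<beta> * (real (weight n t) - card (snd p))) * exp (\<beta> / 2 * card (snd p))"
          using small[OF \<Phi>(2)[OF p]] unfolding small_def by (intro mult_left_mono) auto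
        also have "\<dots> = exp (\<beta> * weight n t - \<beta> / 2 * card (snd p))"
          by (simp add: algebra_simps flip: exp_add)
        also have "\<dots> \<le> exp (\<beta> * weight n t - \<beta> / 2 * \<gamma> * real n ^ 2)"
          using mult_left_mono[OF \<Phi>(4)[OF p], of "\<beta> / 2"] assms(4) by simp
        finally show "(\<Sum>Y\<in>small (snd p). exp (\<beta> * weight n (g (p, Y))))
          \<le> exp (\<beta> * weight n t - \<beta> / 2 * \<gamma> * real n ^ 2)" .
      qed
      also have "\<dots> = card \<Phi> * exp (\<beta> * weight n t - \<beta> / 2 * \<gamma> * real n ^ 2)"
        by simp
      also have "\<dots> \<le> exp (\<beta> / 2 * \<gamma> * real n ^ 2) * exp (\<beta> * weight n t - \<beta> / 2 * \<gamma> * real n ^ 2)"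
      proof (rule mult_right_mono)
        have "card \<Phi> \<le> card (fingerprints k m n h t)"
          unfolding \<Phi>_def using fin_fp by (intro card_mono) auto
        then show "real (card \<Phi>) \<le> exp (\<beta> / 2 * \<gamma> * real n ^ 2)"
          using n\<^sub>1[of n h t] n by (meson max.boundedE of_nat_mono order_trans)
      qed simp
      also have "\<dots> = exp (\<beta> * weight n t)"
        by (simp flip: exp_add)
      finally show ?thesis .
    qed
    moreover have "P n \<inter> realisations n t \<subseteq> (\<Union>s\<in>T. realisations n s)"
    proof
      fix c assume "c \<in> P n \<inter> realisations n t"
      then have c: "c \<in> P n" "c \<in> realisations n t"
        by auto
      have mn: "m \<le> n"
        using n by simp
      obtain b j w where b: "b \<in> colourings k m" and j: "j < card (edges m)"
        and w: "w \<in> ({1..m} - h j) \<rightarrow>\<^sub>E {1..n}"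
        and large: "\<gamma> * real n ^ 2 \<le> card (fibre_edges m n h b t c j w)"
        and rare: "1 / \<theta> * card {f \<in> fibre_edges m n h b t c j w. c f = b (h j)}
          \<le> card (fibre_edges m n h b t c j w)"
        using rich mn t c bad by blast
      have hj: "h j \<in> edges m"
        using h j bij_betwE by blast
      define F where "F = fibre_edges m n h b t c j w"
      define R where "R = edges_touching n (w ` ({1..m} - h j))"
      have "c \<in> edges n \<rightarrow>\<^sub>E {1..k}"
        using c(2) realisations_subset_colourings[OF t] by (auto simp: colourings_def)
      then have "restrict c R \<in> R \<rightarrow>\<^sub>E {1..k}"
        unfolding restrict_PiE_iff R_def using edges_touching_subset by blast
      then have "(b (h j), fibre_edges m n h b t (restrict c R) j w) \<in> fingerprints k m n h t"
        unfolding fingerprints_def using b j w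
        by (intro image_eqI[of _ _ "(b, j, w, restrict c R)"]) (auto simp: R_def)
      then have "(b (h j), F) \<in> fingerprints k m n h t"
        unfolding R_def F_def fibre_edges_restrict[OF h j] .
      then have p: "(b (h j), F) \<in> \<Phi>"
        using large fibre_edges_props(1)[of h j m n b t c w, OF hj]
          fibre_edges_props(2)[of h j m _ n b t c w, OF hj]
        by (auto simp: \<Phi>_def F_def)
      define Y where "Y = {f \<in> F. c f = b (h j)}"
      have "real (card Y) \<le> \<theta> * card F"
        using rare \<theta>(1) by (simp add: Y_def F_def field_simps)
      then have "((b (h j), F), Y) \<in> I"
        using p by (auto simp: I_def small_def Y_def)
      then have "remove_colour n t (b (h j)) (F - Y) \<in> g ` I"
        by (intro image_eqI[of _ g "((b (h j), F), Y)"]) (simp_all add: g_def)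
      moreover have "c \<in> realisations n (remove_colour n t (b (h j)) (F - Y))"
        using c(2) by (intro realisation_remove_colour) (auto simp: Y_def)
      ultimately show "c \<in> (\<Union>s\<in>T. realisations n s)"
        using remove_colour_template[OF t] unfolding T_def by blast
    qed
    ultimately show ?thesis
      by (intro exI[of _ T]) (auto simp: T_def)
  qed
  then show ?thesis
    by blast
qed

text \<open>The step is iterated by induction on the weight. Each final template costs 1, at most
  its own potential, and a step does not increase the total potential, so the potential of
  \<open>t\<close> bounds the number of templates.\<close>

lemma containers:
  fixes \<beta> \<delta> :: real
  assumes "k > 0" "order_hereditary k P" "P m \<noteq> {}" "\<beta> > 0" "\<delta> > 0"
  shows "\<exists>n\<^sub>0. \<forall>n\<ge>n\<^sub>0. \<forall>t\<in>templates k n.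
      (\<exists>T\<subseteq>templates k n. P n \<inter> realisations n t \<subseteq> (\<Union>s\<in>T. realisations n s) \<and>
        (\<forall>s\<in>T. real (card (bad_pairs P m n s)) \<le> \<delta> * real (n choose m)) \<and>
        real (card T) \<le> exp (\<beta> * weight n t))"
\<comment> \<open>The stability hypothesis may supply any \<open>m\<close>. For \<open>m < 2\<close>
  there is a single colouring, which lies in \<open>P m\<close>, so \<open>t\<close> covers itself
  without bad pairs.\<close>
proof (cases "m < 2")
  case True
  have "\<exists>T\<subseteq>templates k n. P n \<inter> realisations n t \<subseteq> (\<Union>s\<in>T. realisations n s) \<and>
        (\<forall>s\<in>T. real (card (bad_pairs P m n s)) \<le> \<delta> * real (n choose m)) \<and>
        real (card T) \<le> exp (\<beta> * weight n t)" if "t \<in> templates k n" for n t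
    using that assms(4,5) bad_pairs_empty[OF assms(2,3) True] by (intro exI[of _ "{t}"]) auto
  then show ?thesis
    by blast
next
  case False
  then have "2 \<le> m"
    by simp
  from container_step[OF assms(1,2) this assms(4,5)]
  obtain n\<^sub>0 where step: "\<forall>n\<ge>n\<^sub>0. \<forall>t\<in>templates k n.
      real (card (bad_pairs P m n t)) > \<delta> * real (n choose m) \<longrightarrow>
      (\<exists>T\<subseteq>templates k n. P n \<inter> realisations n t \<subseteq> (\<Union>s\<in>T. realisations n s) \<and>
        (\<forall>s\<in>T. weight n s < weight n t) \<and>
        (\<Sum>s\<in>T. exp (\<beta> * weight n s)) \<le> exp (\<beta> * weight n t))"
    by (elim exE)
  have "\<exists>T\<subseteq>templates k n. P n \<inter> realisations n t \<subseteq> (\<Union>s\<in>T. realisations n s) \<and>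
        (\<forall>s\<in>T. real (card (bad_pairs P m n s)) \<le> \<delta> * real (n choose m)) \<and>
        real (card T) \<le> exp (\<beta> * weight n t)" if n: "n \<ge> n\<^sub>0" and "t \<in> templates k n" for n t
    using that(2)
  proof (induction "weight n t" arbitrary: t rule: less_induct)
    case less
    show ?case
    proof (cases "real (card (bad_pairs P m n t)) \<le> \<delta> * real (n choose m)")
      case True
      then show ?thesis
        using less.prems assms(4) by (intro exI[of _ "{t}"]) auto
    next
      case False
      then obtain T where T: "T \<subseteq> templates k n" "P n \<inter> realisations n t \<subseteq> (\<Union>s\<in>T. realisations n s)"
        "\<And>s. s \<in> T \<Longrightarrow> weight n s < weight n t"
        "(\<Sum>s\<in>T. exp (\<beta> * weight n s)) \<le> exp (\<beta> * weight n t)"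
        using step[rule_format, OF n less.prems] by force
      have "\<forall>s\<in>T. \<exists>U. U \<subseteq> templates k n \<and> P n \<inter> realisations n s \<subseteq> (\<Union>u\<in>U. realisations n u) \<and>
        (\<forall>u\<in>U. real (card (bad_pairs P m n u)) \<le> \<delta> * real (n choose m)) \<and>
        real (card U) \<le> exp (\<beta> * weight n s)"
        using less.hyps T(1,3) by blast
      from bchoice[OF this] obtain U where "\<forall>s\<in>T. U s \<subseteq> templates k n \<and>
        P n \<inter> realisations n s \<subseteq> (\<Union>u\<in>U s. realisations n u) \<and>
        (\<forall>u\<in>U s. real (card (bad_pairs P m n u)) \<le> \<delta> * real (n choose m)) \<and>
        real (card (U s)) \<le> exp (\<beta> * weight n s)"
        by (elim exE)
      then have U: "\<And>s. s \<in> T \<Longrightarrow> U s \<subseteq> templates k n"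
        "\<And>s. s \<in> T \<Longrightarrow> P n \<inter> realisations n s \<subseteq> (\<Union>u\<in>U s. realisations n u)"
        "\<And>s u. s \<in> T \<Longrightarrow> u \<in> U s \<Longrightarrow> real (card (bad_pairs P m n u)) \<le> \<delta> * real (n choose m)"
        "\<And>s. s \<in> T \<Longrightarrow> real (card (U s)) \<le> exp (\<beta> * weight n s)"
        by blast+
      have "finite T"
        using T(1) finite_templates finite_subset by blast
      then have "real (card (\<Union>s\<in>T. U s)) \<le> real (\<Sum>s\<in>T. card (U s))"
        by (intro of_nat_mono card_UN_le)
      also have "\<dots> \<le> (\<Sum>s\<in>T. exp (\<beta> * weight n s))"
        unfolding of_nat_sum by (intro sum_mono U(4))
      also note T(4)
      finally have "real (card (\<Union>s\<in>T. U s)) \<le> exp (\<beta> * weight n t)" .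
      moreover have "P n \<inter> realisations n t \<subseteq> (\<Union>u\<in>(\<Union>s\<in>T. U s). realisations n u)"
      proof
        fix c assume c: "c \<in> P n \<inter> realisations n t"
        then obtain s where "s \<in> T" "c \<in> realisations n s"
          using T(2) by blast
        then show "c \<in> (\<Union>u\<in>(\<Union>s\<in>T. U s). realisations n u)"
          using U(2)[of s] c by blast
      qed
      ultimately show ?thesis
        using U(1,3) by (intro exI[of _ "\<Union>s\<in>T. U s"]) blast
    qed
  qed
  then show ?thesis
    by blast
qed

section \<open>Stability\<close>

text \<open>Keep the colours of \<open>c\<close> where the two templates agree and choose allowed
  ones elsewhere; the resulting realisation of \<open>ts n\<close> differs from \<open>c\<close>
  only where the templates differ.\<close>

lemma family_distance_le_edit_distance:
  assumes "S \<subseteq> template_sequences k" "ts \<in> S" "c \<in> realisations n t"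
  shows "family_distance n c S \<le> edit_distance n t (ts n)"
proof -
  have ts: "ts n \<in> templates k n"
    using assms(1,2) by (auto simp: template_sequences_def)
  define c' where "c' = (\<lambda>e\<in>edges n. if t e = ts n e then c e else (SOME i. i \<in> ts n e))"
  have "c' e \<in> ts n e" if e: "e \<in> edges n" for e
    using realisation_mem[OF assms(3) e] template_nonempty[OF ts e] e
    by (auto simp: c'_def some_in_eq)
  then have "c' \<in> realisations n (ts n)"
    unfolding realisations_def by (intro PiE_I) (auto simp: c'_def)
  moreover have "finite {edit_distance n c c' | c'. \<exists>ts\<in>S. c' \<in> realisations n (ts n)}"
  proof (rule finite_subset)
    show "{edit_distance n c c' | c'. \<exists>ts\<in>S. c' \<in> realisations n (ts n)} \<subseteq> {..card (edges n)}"
      by (auto simp: edit_distance_def intro!: card_mono)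
  qed simp
  ultimately have "family_distance n c S \<le> edit_distance n c c'"
    unfolding family_distance_def using assms(2) by (intro Min_le) auto
  also have "\<dots> \<le> edit_distance n t (ts n)"
    unfolding edit_distance_def by (rule card_mono) (auto simp: c'_def)
  finally show ?thesis .
qed

lemma real_choose_two_ge:
  assumes "n \<ge> 2"
  shows "real n ^ 2 / 4 \<le> real (n choose 2)"
proof -
  have "real n * real n \<le> real n * (2 * real (n - 1))"
    using assms by (intro mult_left_mono) auto
  then show ?thesis
    by (simp add: real_choose_two power2_eq_square)
qed

theorem theorem2p19:
  fixes k :: nat and P :: "nat \<Rightarrow> colouring set" and S :: "(nat \<Rightarrow> template) set"
  assumes "k \<ge> 2"
    and "order_hereditary k P"
    and "\<And>n. P n \<noteq> {}"
    and "strong_stability_family k P S"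
  shows "\<forall>\<epsilon>::real. \<epsilon> > 0 \<longrightarrow>
    (\<exists>n\<^sub>0 :: nat. \<forall>n\<ge>n\<^sub>0.
      real (card {c \<in> P n. real (family_distance n c S) > \<epsilon> * real (n choose 2)})
        \<le> \<epsilon> * real (card (P n)))"
proof (intro allI impI)
  fix \<epsilon> :: real assume \<epsilon>: "\<epsilon> > 0"
  have S: "S \<subseteq> template_sequences k"
    using assms(4) by (simp add: strong_stability_family_def)
  obtain \<delta> m n\<^sub>1 where \<delta>: "\<delta> > 0"
    and stable: "\<forall>n\<ge>n\<^sub>1. \<forall>t\<in>templates k n.
          Ent k n t \<ge> (entropy_density k P - \<delta>) * real (n choose 2) \<longrightarrow>
          real (card (bad_pairs P m n t)) \<le> \<delta> * real (n choose m) \<longrightarrow>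
          (\<exists>ts\<in>S. real (edit_distance n t (ts n)) \<le> \<epsilon> * real (n choose 2))"
    using assms(4) \<epsilon> unfolding strong_stability_family_def bad_pairs_def by blast
  \<comment> \<open>With this choice the number \<open>exp (\<beta> * k * N)\<close> of containers
    is \<open>k powr (\<delta> * N / 2)\<close>, using up only half of the entropy gap
    \<open>\<delta> * N\<close>.\<close>
  define \<beta> where "\<beta> = \<delta> * ln k / (2 * k)"
  have \<beta>: "\<beta> > 0" "\<beta> * k = \<delta> * ln k / 2"
    using assms(1) \<delta> by (simp_all add: \<beta>_def)
  have "0 < k"
    using assms(1) by simp
  from containers[OF this assms(2) assms(3)[of m] \<beta>(1) \<delta>] obtain n\<^sub>2 where container: "\<forall>n\<ge>n\<^sub>2. \<forall>t\<in>templates k n.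
      (\<exists>T\<subseteq>templates k n. P n \<inter> realisations n t \<subseteq> (\<Union>s\<in>T. realisations n s) \<and>
        (\<forall>s\<in>T. real (card (bad_pairs P m n s)) \<le> \<delta> * real (n choose m)) \<and>
        real (card T) \<le> exp (\<beta> * weight n t))"
    by (elim exE)
  obtain n\<^sub>3 where n\<^sub>3: "\<And>n. n \<ge> n\<^sub>3 \<Longrightarrow> 1 / \<epsilon> * exp (0 * real n) \<le> exp (\<beta> * k / 4 * real n ^ 2)"
    using exp_linear_le_exp_quadratic[of "\<beta> * k / 4" "1 / \<epsilon>" 0] \<beta>(1) \<open>0 < k\<close> by auto
  have "real (card {c \<in> P n. real (family_distance n c S) > \<epsilon> * real (n choose 2)})
      \<le> \<epsilon> * real (card (P n))" if "n \<ge> max (max n\<^sub>1 n\<^sub>2) (max n\<^sub>3 2)" for n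
  proof -
    have n: "n \<ge> n\<^sub>1" "n \<ge> n\<^sub>2" "n \<ge> n\<^sub>3" "n \<ge> 2"
      using that by auto
    define N where "N = real (n choose 2)"
    define far where "far = {c \<in> P n. real (family_distance n c S) > \<epsilon> * N}"
    \<comment> \<open>The containers are built inside the template that allows every colour, so they
      cover all of \<open>P n\<close>.\<close>
    define full :: template where "full = (\<lambda>e\<in>edges n. {1..k})"
    have full: "full \<in> templates k n" "realisations n full = colourings k n"
    proof -
      show "full \<in> templates k n"
        using \<open>0 < k\<close> by (auto simp: full_def templates_def)
      show "realisations n full = colourings k n"
        unfolding realisations_def colourings_def by (rule PiE_cong) (simp add: full_def)
    qed
    have "weight n full = (\<Sum>e\<in>edges n. k)"
      unfolding weight_def by (intro sum.cong) (auto simp: full_def)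
    then have weight: "real (weight n full) = k * N"
      by (simp add: N_def card_edges)
    from container[rule_format, OF n(2) full(1)] obtain T where T: "T \<subseteq> templates k n"
      "P n \<inter> realisations n full \<subseteq> (\<Union>s\<in>T. realisations n s)"
      "\<forall>s\<in>T. real (card (bad_pairs P m n s)) \<le> \<delta> * real (n choose m)"
      "real (card T) \<le> exp (\<beta> * weight n full)"
      by (elim exE conjE)
    have cover: "P n \<subseteq> (\<Union>s\<in>T. realisations n s)"
      using T(2) property_subset[OF assms(1-3), of n] unfolding full(2) by blast
    have card_T: "real (card T) \<le> exp (\<beta> * k * N)"
      using T(4) unfolding weight by (simp add: mult.assoc)
    have "finite T"
      using T(1) finite_templates finite_subset by blast
    \<comment> \<open>By stability a container outside \<open>U\<close> is close to the family, and
      so are all its realisations. Only containers of low entropy can hold far colourings.\<close>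
    define U where "U = {s \<in> T. Ent k n s < (entropy_density k P - \<delta>) * N}"
    have "far \<subseteq> (\<Union>s\<in>U. realisations n s)"
    proof
      fix c assume c: "c \<in> far"
      then obtain s where s: "s \<in> T" "c \<in> realisations n s"
        using cover unfolding far_def by blast
      have False if rich: "\<not> Ent k n s < (entropy_density k P - \<delta>) * N"
      proof -
        obtain ts where "ts \<in> S" "real (edit_distance n s (ts n)) \<le> \<epsilon> * N"
          using stable[rule_format, OF n(1), of s] T(1,3) s(1) rich unfolding N_def
          by (meson in_mono not_less)
        then show False
          using family_distance_le_edit_distance[OF S _ s(2), of ts] c by (auto simp: far_def)
      qed
      then show "c \<in> (\<Union>s\<in>U. realisations n s)"
        using s by (auto simp: U_def)
    qed
    moreover have U: "finite U" "\<And>s. s \<in> U \<Longrightarrow> s \<in> templates k n"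
      using \<open>finite T\<close> T(1) by (auto simp: U_def)
    then have "finite (realisations n s)" if "s \<in> U" for s
      using that finite_subset[OF realisations_subset_colourings finite_colourings] by blast
    ultimately have "card far \<le> card (\<Union>s\<in>U. realisations n s)"
      using U(1) by (intro card_mono finite_UN_I)
    also have "\<dots> \<le> (\<Sum>s\<in>U. card (realisations n s))"
      using U(1) by (rule card_UN_le)
    finally have "real (card far) \<le> real (\<Sum>s\<in>U. card (realisations n s))"
      by (rule of_nat_mono)
    also have "\<dots> = (\<Sum>s\<in>U. real (card (realisations n s)))"
      by simp
    also have "\<dots> \<le> (\<Sum>s\<in>U. k powr ((entropy_density k P - \<delta>) * N))"
    proof (rule sum_mono)
      fix s assume "s \<in> U"
      then have "s \<in> templates k n" "Ent k n s \<le> (entropy_density k P - \<delta>) * N"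
        using T(1) by (auto simp: U_def)
      then show "real (card (realisations n s)) \<le> k powr ((entropy_density k P - \<delta>) * N)"
        using assms(1) by (simp add: card_realisations powr_mono)
    qed
    also have "\<dots> \<le> card T * k powr ((entropy_density k P - \<delta>) * N)"
      using \<open>finite T\<close> by (auto simp: U_def intro!: mult_right_mono card_mono)
    also have "\<dots> \<le> exp (\<beta> * k * N) * k powr ((entropy_density k P - \<delta>) * N)"
      using card_T by (intro mult_right_mono) auto
    \<comment> \<open>By the choice of \<open>\<beta>\<close> the factor
      \<open>k powr (- \<delta> * N)\<close> equals
      \<open>exp (- 2 * \<beta> * k * N)\<close>.\<close>
    also have "\<dots> = exp (- (\<beta> * k * N)) * k powr (entropy_density k P * N)"
      using \<open>0 < k\<close> \<beta>(2) by (simp add: powr_def algebra_simps flip: exp_add)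
    also have "\<dots> \<le> \<epsilon> * k powr (entropy_density k P * N)"
    proof (rule mult_right_mono)
      have "1 / \<epsilon> \<le> exp (\<beta> * k / 4 * real n ^ 2)"
        using n\<^sub>3[OF n(3)] by simp
      also have "\<dots> \<le> exp (\<beta> * k * N)"
        using mult_left_mono[OF real_choose_two_ge[OF n(4)], of "\<beta> * k"] \<beta>(1) by (simp add: N_def)
      finally show "exp (- (\<beta> * k * N)) \<le> \<epsilon>"
        using \<epsilon> by (simp add: exp_minus field_simps)
    qed simp
    also have "\<dots> \<le> \<epsilon> * real (card (P n))"
      using card_property_ge[OF assms(1-3) n(4)] \<epsilon> by (intro mult_left_mono) (auto simp: N_def)
    finally show ?thesis
      by (simp add: far_def N_def)
  qed
  then show "\<exists>n\<^sub>0. \<forall>n\<ge>n\<^sub>0. real (card {c \<in> P n. real (family_distance n c S) > \<epsilon> * real (n choose 2)})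
      \<le> \<epsilon> * real (card (P n))"
    by blast
qed

end
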